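(* Let $B:l^\infty\to l^\infty$, $B(x_1,x_2,x_3,\ldots)=(x_2,x_3,\ldots)$, be the backward shift and let $f$ be a holomorphic function in a neighborhood of the closed unit disc. Then the following statements are equivalent. (i) $f(B)$ is $J$-class. (ii) $f(\partial\mathbb{D})\cap\overline{\mathbb{D}}=\emptyset$ and $\overline{\mathbb{D}}\subseteq f(\mathbb{D})$.
   Context: $l^\infty$ is the complex Banach space of bounded sequences with the sup-norm, $\mathbb{D}$ is the open unit disc in $\mathbb{C}$, and $f(B)$ is defined by the holomorphic functional calculus. For a bounded linear operator $T$ on a Banach space $X$ and $x\in X$, $J_T(x)$ is the set of all $y\in X$ for which there exist a strictly increasing sequence $(k_n)$ of natural numbers and a sequence $(x_n)$ in $X$ with $x_n\to x$ and $T^{k_n}x_n\to y$. The operator $T$ is called $J$-class if $J_T(x)=X$ for some $x\in X\setminus\{0\}$. *)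

theory Defs
  imports "HOL-Complex_Analysis.Complex_Analysis"
begin

section \<open>Complex Banach spaces\<close>

class complex_normed_vector = real_normed_vector +
  fixes scaleC :: "complex \<Rightarrow> 'a \<Rightarrow> 'a"  (infixr "*\<^sub>C" 75)
  assumes scaleC_add_right: "c *\<^sub>C (x + y) = c *\<^sub>C x + c *\<^sub>C y"
    and scaleC_add_left: "(c + d) *\<^sub>C x = c *\<^sub>C x + d *\<^sub>C x"
    and scaleC_scaleC: "c *\<^sub>C (d *\<^sub>C x) = (c * d) *\<^sub>C x"
    and scaleC_of_real: "of_real r *\<^sub>C x = r *\<^sub>R x"
    and norm_scaleC: "norm (c *\<^sub>C x) = cmod c * norm x"

class complex_banach = complex_normed_vector + banach

lemma bounded_linear_scaleC: "bounded_linear (\<lambda>x::'a::complex_normed_vector. c *\<^sub>C x)"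
proof (rule bounded_linear_intro[where K = "cmod c"])
  fix r :: real and x :: 'a
  show "c *\<^sub>C (r *\<^sub>R x) = r *\<^sub>R (c *\<^sub>C x)"
    by (simp add: scaleC_of_real[symmetric] scaleC_scaleC mult.commute)
qed (simp_all add: scaleC_add_right norm_scaleC mult.commute)

instantiation complex :: complex_banach
begin

definition scaleC_complex :: "complex \<Rightarrow> complex \<Rightarrow> complex"
  where "scaleC_complex c z = c * z"

instance
  by standard (simp_all add: scaleC_complex_def algebra_simps norm_mult scaleR_conv_of_real)

end

instantiation bcontfun :: (topological_space, complex_normed_vector) complex_normed_vector
begin

definition scaleC_bcontfun :: "complex \<Rightarrow> ('a \<Rightarrow>\<^sub>C 'b) \<Rightarrow> 'a \<Rightarrow>\<^sub>C 'b"
  where "scaleC_bcontfun c f = Bcontfun (\<lambda>x. c *\<^sub>C apply_bcontfun f x)"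

lemma apply_bcontfun_scaleC [simp]:
  "apply_bcontfun (c *\<^sub>C f) x = c *\<^sub>C apply_bcontfun f x" for f :: "'a \<Rightarrow>\<^sub>C 'b"
proof -
  have "(\<lambda>x. c *\<^sub>C apply_bcontfun f x) \<in> bcontfun"
  proof (rule bcontfun_normI)
    show "continuous_on UNIV (\<lambda>x. c *\<^sub>C apply_bcontfun f x)"
      by (rule bounded_linear.continuous_on[OF bounded_linear_scaleC]) simp
    show "norm (c *\<^sub>C apply_bcontfun f x) \<le> cmod c * norm f" for x
      by (simp add: norm_scaleC mult_left_mono norm_bounded)
  qed
  then show ?thesis
    by (simp add: scaleC_bcontfun_def Bcontfun_inverse)
qed

instance
proof
  fix c d :: complex and r :: real and f g :: "'a \<Rightarrow>\<^sub>C 'b"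
  show "c *\<^sub>C (f + g) = c *\<^sub>C f + c *\<^sub>C g" "(c + d) *\<^sub>C f = c *\<^sub>C f + d *\<^sub>C f"
    "c *\<^sub>C (d *\<^sub>C f) = (c * d) *\<^sub>C f" and r: "of_real r *\<^sub>C f = r *\<^sub>R f" for r
    by (auto intro!: bcontfun_eqI
        simp: scaleC_add_right scaleC_add_left scaleC_scaleC scaleC_of_real)
  have le: "norm (a *\<^sub>C h) \<le> cmod a * norm h" for a and h :: "'a \<Rightarrow>\<^sub>C 'b"
    by (rule norm_bound) (simp add: norm_scaleC mult_left_mono norm_bounded)
  show "norm (c *\<^sub>C f) = cmod c * norm f"
  proof (cases "c = 0")
    case True
    then show ?thesis using r[of 0] by simp
  next
    case False
    have "inverse c *\<^sub>C (c *\<^sub>C f) = f"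
      using False r[of 1]
      by (auto intro!: bcontfun_eqI simp: scaleC_scaleC scaleC_of_real[of 1, simplified])
    then have "norm f \<le> inverse (cmod c) * norm (c *\<^sub>C f)"
      using le[of "inverse c" "c *\<^sub>C f"] by (simp add: norm_inverse)
    then show ?thesis
      using False le[of c f] by (simp add: field_simps)
  qed
qed

end

text \<open>The library has completeness only for metric domains, and \<^typ>\<open>nat\<close> is not an instance of
  \<^class>\<open>metric_space\<close>, but the domain may be any topological space.\<close>

instance bcontfun :: (topological_space, complete_space) complete_space
proof
  fix F :: "nat \<Rightarrow> 'a \<Rightarrow>\<^sub>C 'b"
  assume F: "Cauchy F"
  have "uniformly_Cauchy_on UNIV (\<lambda>n. apply_bcontfun (F n))"
  proof (rule uniformly_Cauchy_onI)
    fix e :: real assume "e > 0"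
    then obtain M where "\<forall>m\<ge>M. \<forall>n\<ge>M. dist (F m) (F n) < e"
      using F by (auto simp: Cauchy_def)
    then show "\<exists>M. \<forall>x\<in>UNIV. \<forall>m\<ge>M. \<forall>n\<ge>M. dist (F m x) (F n x) < e"
      by (meson dist_fun_lt_imp_dist_val_lt)
  qed
  then obtain g where "uniform_limit UNIV (\<lambda>n. apply_bcontfun (F n)) g sequentially"
    using Cauchy_uniformly_convergent uniformly_convergent_on_def by blast
  then show "convergent F"
    by (rule uniform_limit_bcontfunE) (auto intro: convergentI)
qed

instance bcontfun :: (topological_space, complex_banach) complex_banach ..

instantiation blinfun :: (real_normed_vector, complex_normed_vector) complex_normed_vector
begin

definition scaleC_blinfun :: "complex \<Rightarrow> ('a \<Rightarrow>\<^sub>L 'b) \<Rightarrow> 'a \<Rightarrow>\<^sub>L 'b"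
  where "scaleC_blinfun c T = Blinfun (\<lambda>x. c *\<^sub>C blinfun_apply T x)"

lemma blinfun_apply_scaleC [simp]:
  "blinfun_apply (c *\<^sub>C T) x = c *\<^sub>C blinfun_apply T x" for T :: "'a \<Rightarrow>\<^sub>L 'b"
  unfolding scaleC_blinfun_def
  by (subst bounded_linear_Blinfun_apply)
    (auto intro: bounded_linear_compose[OF bounded_linear_scaleC blinfun.bounded_linear_right])

instance
proof
  fix c d :: complex and r :: real and S T :: "'a \<Rightarrow>\<^sub>L 'b"
  show "c *\<^sub>C (S + T) = c *\<^sub>C S + c *\<^sub>C T" "(c + d) *\<^sub>C S = c *\<^sub>C S + d *\<^sub>C S"
    "c *\<^sub>C (d *\<^sub>C S) = (c * d) *\<^sub>C S" and r: "of_real r *\<^sub>C S = r *\<^sub>R S" for r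
    by (auto intro!: blinfun_eqI simp: blinfun.add_left blinfun.scaleR_left
        scaleC_add_right scaleC_add_left scaleC_scaleC scaleC_of_real)
  have le: "norm (a *\<^sub>C R) \<le> cmod a * norm R" for a and R :: "'a \<Rightarrow>\<^sub>L 'b"
    by (rule norm_blinfun_bound)
      (auto simp: norm_scaleC mult.assoc intro!: mult_left_mono norm_blinfun)
  show "norm (c *\<^sub>C S) = cmod c * norm S"
  proof (cases "c = 0")
    case True
    then show ?thesis using r[of 0] by simp
  next
    case False
    have "inverse c *\<^sub>C (c *\<^sub>C S) = S"
      using False by (auto intro!: blinfun_eqI simp: scaleC_scaleC scaleC_of_real[of 1, simplified])
    then have "norm S \<le> inverse (cmod c) * norm (c *\<^sub>C S)"
      using le[of "inverse c" "c *\<^sub>C S"] by (simp add: norm_inverse)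
    then show ?thesis
      using False le[of c S] by (simp add: field_simps)
  qed
qed

end

instance blinfun :: (real_normed_vector, complex_banach) complex_banach ..


section \<open>Holomorphic functional calculus\<close>

text \<open>
  The type \<open>'a \<Rightarrow>\<^sub>L 'a\<close> consists of the bounded real-linear operators. The notions below are meant
  for complex-linear \<open>T\<close>; an inverse of \<open>\<lambda> - T\<close> is then complex-linear automatically, so that
  spectrum and resolvent are the usual complex ones.
\<close>

definition is_resolvent :: "('a::complex_banach \<Rightarrow>\<^sub>L 'a) \<Rightarrow> complex \<Rightarrow> ('a \<Rightarrow>\<^sub>L 'a) \<Rightarrow> bool"
  where "is_resolvent T l R \<longleftrightarrow>
    R o\<^sub>L (l *\<^sub>C id_blinfun - T) = id_blinfun \<and> (l *\<^sub>C id_blinfun - T) o\<^sub>L R = id_blinfun"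

definition spectrum :: "('a::complex_banach \<Rightarrow>\<^sub>L 'a) \<Rightarrow> complex set"
  where "spectrum T = {l. \<not> (\<exists>R. is_resolvent T l R)}"

definition resolvent :: "('a::complex_banach \<Rightarrow>\<^sub>L 'a) \<Rightarrow> complex \<Rightarrow> 'a \<Rightarrow>\<^sub>L 'a"
  where "resolvent T l = (THE R. is_resolvent T l R)"

text \<open>A contour is a finite list of piecewise \<open>C\<^sup>1\<close> loops, i.e. a cycle; it surrounds \<open>K\<close> in \<open>U\<close>
  if its index is 1 on \<open>K\<close> and 0 off \<open>U\<close>.\<close>

definition surrounds :: "(real \<Rightarrow> complex) list \<Rightarrow> complex set \<Rightarrow> complex set \<Rightarrow> bool"
  where "surrounds \<Gamma> K U \<longleftrightarrow>
    (\<forall>\<gamma>\<in>set \<Gamma>. valid_path \<gamma> \<and> pathfinish \<gamma> = pathstart \<gamma> \<and> path_image \<gamma> \<subseteq> U - K) \<and>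
    (\<forall>z\<in>K. (\<Sum>\<gamma>\<leftarrow>\<Gamma>. winding_number \<gamma> z) = 1) \<and>
    (\<forall>z. z \<notin> U \<longrightarrow> (\<Sum>\<gamma>\<leftarrow>\<Gamma>. winding_number \<gamma> z) = 0)"

text \<open>The analogue of \<^const>\<open>contour_integral\<close> for functions with values in a complex Banach space.\<close>

definition vector_contour_integral ::
    "(real \<Rightarrow> complex) \<Rightarrow> (complex \<Rightarrow> 'b::complex_banach) \<Rightarrow> 'b"
  where "vector_contour_integral \<gamma> F =
    integral {0..1} (\<lambda>t. vector_derivative \<gamma> (at t within {0..1}) *\<^sub>C F (\<gamma> t))"

text \<open>\<open>f(T) = 1/(2\<pi>i) \<integral>\<^sub>\<Gamma> f(\<lambda>) (\<lambda> - T)\<^sup>-\<^sup>1 d\<lambda>\<close>, the integral converging in operator norm, for \<open>f\<close>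
  holomorphic on the open set \<open>U\<close> containing the spectrum of \<open>T\<close> and any contour \<open>\<Gamma>\<close>
  surrounding the spectrum in \<open>U\<close>. By Cauchy's theorem the choice of \<open>\<Gamma>\<close> is immaterial.\<close>

definition holomorphic_calculus ::
    "complex set \<Rightarrow> (complex \<Rightarrow> complex) \<Rightarrow> ('a::complex_banach \<Rightarrow>\<^sub>L 'a) \<Rightarrow> 'a \<Rightarrow>\<^sub>L 'a"
  where "holomorphic_calculus U f T =
    (let \<Gamma> = (SOME \<Gamma>. surrounds \<Gamma> (spectrum T) U)
     in (1 / (2 * of_real pi * \<i>)) *\<^sub>C
        (\<Sum>\<gamma>\<leftarrow>\<Gamma>. vector_contour_integral \<gamma> (\<lambda>l. f l *\<^sub>C resolvent T l)))"


section \<open>J-class operators\<close>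

definition J_set :: "('a::real_normed_vector \<Rightarrow>\<^sub>L 'a) \<Rightarrow> 'a \<Rightarrow> 'a set"
  where "J_set T x = {y. \<exists>(k::nat \<Rightarrow> nat) (xs::nat \<Rightarrow> 'a). strict_mono k \<and> xs \<longlonglongrightarrow> x \<and>
    (\<lambda>n. (blinfun_apply T ^^ k n) (xs n)) \<longlonglongrightarrow> y}"

definition J_class :: "('a::real_normed_vector \<Rightarrow>\<^sub>L 'a) \<Rightarrow> bool"
  where "J_class T \<longleftrightarrow> (\<exists>x. x \<noteq> 0 \<and> J_set T x = UNIV)"


section \<open>The backward shift on the bounded sequences\<close>

text \<open>Since the topology of \<^typ>\<open>nat\<close> is discrete, \<open>nat \<Rightarrow>\<^sub>C complex\<close> is the space of all bounded
  complex sequences with the sup-norm. Sequences are indexed from 0.\<close>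

type_synonym linf = "nat \<Rightarrow>\<^sub>C complex"

definition backward_shift :: "linf \<Rightarrow>\<^sub>L linf"
  where "backward_shift = Blinfun (\<lambda>x. Bcontfun (\<lambda>n. apply_bcontfun x (Suc n)))"

text \<open>The arguments of \<^const>\<open>Blinfun\<close> and \<^const>\<open>Bcontfun\<close> lie in the representing sets, so these
  are not junk values, and the operator is complex-linear.\<close>

lemma backward_shift_apply [simp]:
  "apply_bcontfun (blinfun_apply backward_shift x) n = apply_bcontfun x (Suc n)"
proof -
  define S where "S = (\<lambda>x::linf. Bcontfun (\<lambda>n. apply_bcontfun x (Suc n)))"
  have "(\<lambda>n. apply_bcontfun x (Suc n)) \<in> bcontfun" for x :: linf
    by (rule bcontfun_normI[where b = "norm x"]) (auto simp: norm_bounded)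
  then have *: "apply_bcontfun (S x) n = apply_bcontfun x (Suc n)" for x n
    by (simp add: S_def Bcontfun_inverse)
  have "bounded_linear S"
    by (rule bounded_linear_intro[where K = 1])
      (auto intro!: bcontfun_eqI norm_bound simp: * norm_bounded)
  then show ?thesis
    by (simp add: backward_shift_def S_def[symmetric] bounded_linear_Blinfun_apply *)
qed

lemma backward_shift_scaleC:
  "blinfun_apply backward_shift (c *\<^sub>C x) = c *\<^sub>C blinfun_apply backward_shift x"
  by (rule bcontfun_eqI) simp

end

theory Submission
  imports Defs
begin

text \<open>
  Since \<open>U\<close> need not be connected and a contour is an arbitrary cycle, the independence of the functional
  calculus of the contour rests on the homology version of Cauchy's theorem for cycles (Dixon's proof). It
  gives \<open>(f(B) x)\<^sub>m = \<Sum>\<^sub>j a\<^sub>j x\<^sub>m\<^sub>+\<^sub>j\<close>, where \<open>a\<^sub>j\<close> are the Taylor coefficients of \<open>f\<close>: a triangular Toeplitz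
  operator.

  If \<open>\<bar>f\<bar> > 1\<close> on the unit circle, the Toeplitz operators \<open>S\<^sub>n\<close> with symbol \<open>f\<^sup>-\<^sup>n\<close> are right inverses of
  \<open>f(B)\<^sup>n\<close>, and \<open>\<parallel>S\<^sub>n\<parallel> \<rightarrow> 0\<close>. If moreover \<open>f(z) = 0\<close> with \<open>\<bar>z\<bar> < 1\<close>, perturbing \<open>x = (z\<^sup>m)\<^sub>m\<close> by \<open>S\<^sub>n y\<close>
  shows that \<open>J(x)\<close> is the whole space. If \<open>f\<close> has no zero in the disc, then \<open>S\<^sub>n\<close> is also a left inverse,
  so that \<open>0 \<in> J(x)\<close> only for \<open>x = 0\<close>.

  If \<open>\<bar>f(l)\<bar> \<le> 1\<close> for some \<open>l\<close> on the circle, the upper limit of the Cesaro means of \<open>(l\<^sup>-\<^sup>m x\<^sub>m)\<^sub>m\<close> in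
  absolute value is a seminorm dominated by the norm and not increased by \<open>f(B)\<close>; its value at large
  multiples of \<open>(l\<^sup>m)\<^sub>m\<close> keeps these out of \<open>J(x)\<close>. Finally, \<open>f\<close> has a zero in the disc iff its image covers
  the closed disc: the image of the open disc is relatively open and closed there.
\<close>

section \<open>Cauchy's theorem for cycles\<close>

text \<open>A polynomial loop close to \<open>\<gamma>\<close> gives the same integrals of functions
  holomorphic on \<open>S\<close> and has a bounded derivative, which differentiation under the
  integral asks for. A small translation then moves it off \<open>z\<close>.\<close>

lemma nearby_polynomial_loop:
  assumes "open S" "valid_path \<gamma>" "pathfinish \<gamma> = pathstart \<gamma>" "path_image \<gamma> \<subseteq> S"
  obtains p where "polynomial_function p" "pathfinish p = pathstart p" "path_image p \<subseteq> S" "z \<notin> path_image p"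
    "\<And>g. g holomorphic_on S \<Longrightarrow> contour_integral p g = contour_integral \<gamma> g"
proof -
  have "path \<gamma>"
    using assms valid_path_imp_path by blast
  then obtain d where "0 < d" and d: "\<And>h. valid_path h \<Longrightarrow> (\<forall>t\<in>{0..1}. norm (h t - \<gamma> t) < d) \<Longrightarrow>
      pathfinish h = pathstart h \<Longrightarrow>
      path_image h \<subseteq> S \<and> (\<forall>g. g holomorphic_on S \<longrightarrow> contour_integral h g = contour_integral \<gamma> g)"
    using contour_integral_nearby_loops[of S \<gamma>] assms by (metis diff_self norm_zero)
  obtain q where q: "polynomial_function q" "pathstart q = pathstart \<gamma>" "pathfinish q = pathfinish \<gamma>"
      "\<And>t. t \<in> {0..1} \<Longrightarrow> norm (q t - \<gamma> t) < d/2"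
    using path_approx_polynomial_function[OF \<open>path \<gamma>\<close>, of "d/2"] \<open>0 < d\<close> by auto
  \<comment> \<open>A translation by \<open>c\<close> makes the loop hit \<open>z\<close> exactly if
    \<open>c = z - q t\<close> for some \<open>t\<close>. These values form a smooth curve in the
    plane, which is negligible and so contains no disc.\<close>
  have "(\<lambda>t. z - q t) differentiable_on {0..1}"
    using differentiable_on_polynomial_function[OF q(1)] by (intro derivative_intros) auto
  then have "negligible ((\<lambda>t. z - q t) ` {0..1})"
    by (rule negligible_differentiable_image_lowdim[rotated]) simp
  then have "\<not> ball 0 (d/2) \<subseteq> (\<lambda>t. z - q t) ` {0..1}"
    using \<open>0 < d\<close> by (metis ball_eq_empty half_gt_zero linorder_not_le negligible_subset open_ball open_not_negligible)
  then obtain c where c: "norm c < d/2" "c \<notin> (\<lambda>t. z - q t) ` {0..1}"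
    by (meson mem_ball_0 subsetI)
  define p where "p = (\<lambda>t. q t + c)"
  have p: "polynomial_function p" "pathfinish p = pathstart p"
    using q assms by (auto simp: p_def polynomial_function_add pathstart_def pathfinish_def)
  have "norm (p t - \<gamma> t) < d" if "t \<in> {0..1}" for t
    using norm_triangle_ineq[of "q t - \<gamma> t" c] q(4)[OF that] c(1) by (auto simp: p_def algebra_simps)
  moreover have "z \<notin> path_image p"
    using c(2) by (force simp: p_def path_image_def algebra_simps)
  ultimately show thesis
    using d[of p] p valid_path_polynomial_function that by blast
qed

lemma vector_derivative_polynomial_function_bounded:
  fixes p :: "real \<Rightarrow> 'a::euclidean_space"
  assumes "polynomial_function p"
  obtains B where "\<And>t. t \<in> {0..1} \<Longrightarrow> norm (vector_derivative p (at t)) \<le> B"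
proof -
  obtain p' where p': "polynomial_function p'" "\<And>x. (p has_vector_derivative p' x) (at x)"
    using has_vector_derivative_polynomial_function assms by blast
  then have "compact (p' ` {0..1})"
    by (simp add: compact_continuous_image continuous_on_polymonial_function)
  then obtain B where "\<And>x. x \<in> p' ` {0..1} \<Longrightarrow> norm x \<le> B"
    using bounded_pos compact_imp_bounded by metis
  then show thesis
    using that p'(2) by (metis imageI vector_derivative_at)
qed

text \<open>Differentiability is checked at one point \<open>z\<close>. For every \<open>w\<close>
  in a small disc about \<open>z\<close> the integrand is holomorphic on \<open>U\<close> minus the
  closed disc, so a single polynomial loop serves all these \<open>w\<close>, and its bounded
  derivative admits differentiation under the integral.\<close>

lemma holomorphic_Cauchy_integral:
  assumes \<gamma>: "valid_path \<gamma>" "pathfinish \<gamma> = pathstart \<gamma>" "path_image \<gamma> \<subseteq> U"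
    and U: "open U" "f holomorphic_on U"
  shows "(\<lambda>z. contour_integral \<gamma> (\<lambda>w. f w / (w - z))) holomorphic_on - path_image \<gamma>"
proof -
  have op: "open (- path_image \<gamma>)"
    using closed_valid_path_image \<gamma>(1) by auto
  have "(\<lambda>z. contour_integral \<gamma> (\<lambda>w. f w / (w - z))) field_differentiable at z" if z: "z \<notin> path_image \<gamma>" for z
  proof -
    obtain e where e: "0 < e" "cball z e \<subseteq> - path_image \<gamma>"
      using op z open_contains_cball by blast
    obtain p where p: "polynomial_function p" "path_image p \<subseteq> U - cball z e"
      and eq: "\<And>g. g holomorphic_on U - cball z e \<Longrightarrow> contour_integral p g = contour_integral \<gamma> g"
      using nearby_polynomial_loop[of "U - cball z e" \<gamma>] assms e
      by (metis (no_types, lifting) Diff_eq Int_subset_iff closed_cball compl_le_swap1 open_Diff)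
    have vp: "valid_path p"
      using p(1) valid_path_polynomial_function by blast
    obtain B where B: "\<And>t. t \<in> {0..1} \<Longrightarrow> norm (vector_derivative p (at t)) \<le> B"
      using vector_derivative_polynomial_function_bounded p(1) by blast
    have hol: "(\<lambda>u. f u / (u - w)) holomorphic_on U - cball z e" if "w \<in> ball z e" for w
      using that by (intro holomorphic_intros holomorphic_on_subset[OF U(2)]) auto
    have "((\<lambda>u. f u / (u - w) ^ 1) has_contour_integral contour_integral \<gamma> (\<lambda>u. f u / (u - w))) p"
      if "w \<in> ball z e - path_image p" for w
    proof -
      have "(\<lambda>u. f u / (u - w)) contour_integrable_on p"
        using hol that p(2) vp U(1) by (intro contour_integrable_holomorphic_simple[of _ "U - cball z e"]) auto
      then show ?thesis
        using eq[OF hol[of w]] that has_contour_integral_integral by fastforce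
    qed
    moreover have "continuous_on (path_image p) f"
      using U(2) p(2) by (meson Diff_subset continuous_on_subset holomorphic_on_imp_continuous_on order_trans)
    moreover have "z \<in> ball z e - path_image p"
      using e p(2) by auto
    ultimately show ?thesis
      using Cauchy_next_derivative(2)[of p f B "ball z e" 1 "\<lambda>w. contour_integral \<gamma> (\<lambda>u. f u / (u - w))" z] B vp
      unfolding field_differentiable_def by auto
  qed
  then show ?thesis
    by (simp add: holomorphic_on_def field_differentiable_at_within)
qed

text \<open>The kernel of Dixon's proof. The value at \<open>w = z\<close> removes the
  singularity.\<close>

definition difference_quotient :: "(complex \<Rightarrow> complex) \<Rightarrow> complex \<Rightarrow> complex \<Rightarrow> complex"
  where "difference_quotient f z w = (if w = z then deriv f z else (f w - f z) / (w - z))"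

lemma holomorphic_difference_quotient:
  "open U \<Longrightarrow> f holomorphic_on U \<Longrightarrow> difference_quotient f z holomorphic_on U"
  unfolding difference_quotient_def by (rule pole_lemma_open)

text \<open>Off the path the quotient splits into \<open>f w / (w - z)\<close> and
  \<open>f z / (w - z)\<close>; the second piece integrates to the winding number term.\<close>

lemma contour_integral_difference_quotient:
  assumes \<gamma>: "valid_path \<gamma>" "pathfinish \<gamma> = pathstart \<gamma>" "path_image \<gamma> \<subseteq> U"
    and U: "open U" "f holomorphic_on U" and z: "z \<notin> path_image \<gamma>"
  shows "contour_integral \<gamma> (difference_quotient f z) =
    contour_integral \<gamma> (\<lambda>w. f w / (w - z)) - 2 * pi * \<i> * winding_number \<gamma> z * f z"
proof -
  have int: "(\<lambda>w. f w / (w - z)) contour_integrable_on \<gamma>"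
    using \<gamma> U z
    by (intro contour_integrable_holomorphic_simple[of _ "U - {z}"] holomorphic_intros holomorphic_on_subset[OF U(2)])
      auto
  have "((\<lambda>w. 1 / (w - z) * f z) has_contour_integral (2 * pi * \<i> * winding_number \<gamma> z) * f z) \<gamma>"
    by (intro has_contour_integral_rmul has_contour_integral_winding_number) (use \<gamma> z in auto)
  from has_contour_integral_diff[OF has_contour_integral_integral[OF int] this]
  have "((\<lambda>w. f w / (w - z) - 1 / (w - z) * f z) has_contour_integral
     contour_integral \<gamma> (\<lambda>w. f w / (w - z)) - 2 * pi * \<i> * winding_number \<gamma> z * f z) \<gamma>" .
  moreover have "f w / (w - z) - 1 / (w - z) * f z = difference_quotient f z w" if "w \<in> path_image \<gamma>" for w
    using that z by (auto simp: difference_quotient_def divide_simps)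
  ultimately show ?thesis
    by (metis (no_types, lifting) contour_integral_eq contour_integral_unique)
qed

text \<open>The loop may be moved off the given point, since \<^term>\<open>difference_quotient f z\<close> has no pole.\<close>

lemma holomorphic_contour_integral_difference_quotient:
  assumes \<gamma>: "valid_path \<gamma>" "pathfinish \<gamma> = pathstart \<gamma>" "path_image \<gamma> \<subseteq> U"
    and U: "open U" "f holomorphic_on U"
  shows "(\<lambda>z. contour_integral \<gamma> (difference_quotient f z)) holomorphic_on U"
proof -
  have "(\<lambda>z. contour_integral \<gamma> (difference_quotient f z)) field_differentiable at z" if z: "z \<in> U" for z
  proof -
    obtain p where p: "polynomial_function p" "pathfinish p = pathstart p" "path_image p \<subseteq> U" "z \<notin> path_image p"
      and eq: "\<And>g. g holomorphic_on U \<Longrightarrow> contour_integral p g = contour_integral \<gamma> g"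
      using nearby_polynomial_loop[OF U(1) \<gamma>] by metis
    have vp: "valid_path p"
      using p(1) valid_path_polynomial_function by blast
    have "open (U - path_image p)"
      using U(1) closed_valid_path_image vp by blast
    then obtain e where e: "0 < e" "ball z e \<subseteq> U - path_image p"
      using z p(4) by (metis DiffI openE)
    \<comment> \<open>The winding number of \<open>p\<close> is constant on a disc that misses
      \<open>p\<close>, so the right-hand side is holomorphic in \<open>w\<close>.\<close>
    have eq': "contour_integral \<gamma> (difference_quotient f w) =
        contour_integral p (\<lambda>u. f u / (u - w)) - 2 * pi * \<i> * winding_number p z * f w" if "w \<in> ball z e" for w
    proof -
      have "winding_number p w = winding_number p z"
        using winding_number_eq[of p w "ball z e" z] p(2) vp e that by (auto simp: valid_path_imp_path)
      then show ?thesis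
        using contour_integral_difference_quotient[OF vp p(2,3) U, of w] e that
          eq[OF holomorphic_difference_quotient[OF U]] by auto
    qed
    have "(\<lambda>w. contour_integral p (\<lambda>u. f u / (u - w)) - 2 * pi * \<i> * winding_number p z * f w) holomorphic_on ball z e"
      using e
      by (intro holomorphic_intros holomorphic_on_subset[OF U(2)]
          holomorphic_on_subset[OF holomorphic_Cauchy_integral[OF vp p(2,3) U]]) auto
    then have "(\<lambda>w. contour_integral \<gamma> (difference_quotient f w)) holomorphic_on ball z e"
      by (rule holomorphic_transform) (simp add: eq')
    then show ?thesis
      using e(1) by (meson centre_in_ball holomorphic_on_imp_differentiable_at open_ball)
  qed
  then show ?thesis
    by (simp add: holomorphic_on_def field_differentiable_at_within)
qed

text \<open>The integrand is of order 1/|z|, uniformly near the path.\<close>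

lemma Cauchy_integral_tendsto_0:
  assumes \<gamma>: "valid_path \<gamma>" "path_image \<gamma> \<subseteq> U" and U: "open U" "f holomorphic_on U"
  shows "((\<lambda>z. contour_integral \<gamma> (\<lambda>w. f w / (w - z))) \<longlongrightarrow> 0) at_infinity"
proof -
  have cont: "continuous_on U f"
    using U(2) holomorphic_on_imp_continuous_on by blast
  have cpt: "compact (path_image \<gamma>)"
    using \<gamma>(1) by (simp add: compact_valid_path_image)
  then obtain R where R: "\<And>w. w \<in> path_image \<gamma> \<Longrightarrow> norm w < R"
    using compact_imp_bounded bounded_pos_less by metis
  have "compact (f ` path_image \<gamma>)"
    using cont \<gamma>(2) cpt by (meson compact_continuous_image continuous_on_subset)
  then obtain D where D: "0 < D" "\<And>w. w \<in> path_image \<gamma> \<Longrightarrow> norm (f w) < D"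
    using compact_imp_bounded bounded_pos_less by (metis imageI)
  \<comment> \<open>The constant \<open>L\<close> refers to bounds of the integrand on an open
    neighbourhood of the path; on \<open>V\<close> both \<open>f\<close> and the variable are
    bounded.\<close>
  define V where "V = (U \<inter> f -` ball 0 D) \<inter> ball 0 R"
  have "open V"
    unfolding V_def using cont U(1) by (intro open_Int continuous_open_preimage) auto
  moreover have "path_image \<gamma> \<subseteq> V"
    using \<gamma>(2) R D by (auto simp: V_def)
  ultimately obtain L where L: "0 < L" "\<And>g B. g holomorphic_on V \<Longrightarrow> (\<And>z. z \<in> V \<Longrightarrow> norm (g z) \<le> B) \<Longrightarrow>
      norm (contour_integral \<gamma> g) \<le> L * B"
    using contour_integral_bound_exists[OF _ \<gamma>(1)] by metis
  have bound: "norm (contour_integral \<gamma> (\<lambda>w. f w / (w - z))) \<le> L * (D / (norm z - R))" if z: "norm z > R" for z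
  proof (rule L(2))
    show "(\<lambda>w. f w / (w - z)) holomorphic_on V"
      using z by (intro holomorphic_intros holomorphic_on_subset[OF U(2)]) (auto simp: V_def)
    fix w assume w: "w \<in> V"
    have "norm z - R \<le> norm (w - z)"
      using w norm_triangle_ineq2[of z w] by (auto simp: V_def norm_minus_commute)
    then show "norm (f w / (w - z)) \<le> D / (norm z - R)"
      using w z D(1) by (auto simp: V_def norm_divide intro!: frac_le)
  qed
  have "((\<lambda>x::real. L * (D / (x - R))) \<longlongrightarrow> 0) at_top"
    by real_asymp
  then have "((\<lambda>z::complex. L * (D / (norm z - R))) \<longlongrightarrow> 0) at_infinity"
    by (rule filterlim_compose[OF _ filterlim_norm_at_top])
  moreover have "\<forall>\<^sub>F z::complex in at_infinity. norm (contour_integral \<gamma> (\<lambda>w. f w / (w - z))) \<le> L * (D / (norm z - R))"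
    using bound eventually_at_infinity by (metis (mono_tags, lifting) gt_ex order_less_le_trans)
  ultimately show ?thesis
    by (rule Lim_null_comparison[rotated])
qed

text \<open>Dixon's argument: the sum over the cycle of the integrals of the difference quotients extends to an
  entire function vanishing at infinity.\<close>

lemma Cauchy_cycle_difference_quotient:
  assumes U: "open U" "f holomorphic_on U"
    and \<Gamma>: "\<And>\<gamma>. \<gamma> \<in> set \<Gamma> \<Longrightarrow> valid_path \<gamma> \<and> pathfinish \<gamma> = pathstart \<gamma> \<and> path_image \<gamma> \<subseteq> U"
    and zero: "\<And>z. z \<notin> U \<Longrightarrow> (\<Sum>\<gamma>\<leftarrow>\<Gamma>. winding_number \<gamma> z) = 0"
    and z: "z \<in> U"
  shows "(\<Sum>\<gamma>\<leftarrow>\<Gamma>. contour_integral \<gamma> (difference_quotient f z)) = 0"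
proof -
  define Q where "Q z = (\<Sum>\<gamma>\<leftarrow>\<Gamma>. contour_integral \<gamma> (difference_quotient f z))" for z
  define C where "C z = (\<Sum>\<gamma>\<leftarrow>\<Gamma>. contour_integral \<gamma> (\<lambda>w. f w / (w - z)))" for z
  define h where "h z = (if z \<in> U then Q z else C z)" for z
  define P where "P = (\<Union>\<gamma>\<in>set \<Gamma>. path_image \<gamma>)"
  have P: "closed P" "P \<subseteq> U" "bounded P"
    using \<Gamma> compact_valid_path_image by (auto simp: P_def intro!: closed_UN closed_valid_path_image compact_imp_bounded)
  have holQ: "Q holomorphic_on U"
    using \<Gamma> U unfolding Q_def
    by (induction \<Gamma>) (auto intro!: holomorphic_intros holomorphic_contour_integral_difference_quotient)
  have "(\<lambda>z. contour_integral \<gamma> (\<lambda>w. f w / (w - z))) holomorphic_on - P" if "\<gamma> \<in> set \<Gamma>" for \<gamma>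
    using \<Gamma>[OF that] that U by (intro holomorphic_on_subset[OF holomorphic_Cauchy_integral]) (auto simp: P_def)
  then have holC: "C holomorphic_on - P"
    unfolding C_def by (induction \<Gamma>) (auto intro!: holomorphic_on_add)
  have "((\<lambda>z. contour_integral \<gamma> (\<lambda>w. f w / (w - z))) \<longlongrightarrow> 0) at_infinity" if "\<gamma> \<in> set \<Gamma>" for \<gamma>
    using \<Gamma>[OF that] U by (intro Cauchy_integral_tendsto_0[of _ U]) auto
  then have limC: "(C \<longlongrightarrow> 0) at_infinity"
    unfolding C_def by (induction \<Gamma>) (auto intro!: tendsto_add_zero)
  have QC: "Q z = C z - 2 * pi * \<i> * (\<Sum>\<gamma>\<leftarrow>\<Gamma>. winding_number \<gamma> z) * f z" if "z \<notin> P" for z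
  proof -
    have "contour_integral \<gamma> (difference_quotient f z) =
        contour_integral \<gamma> (\<lambda>w. f w / (w - z)) - 2 * pi * \<i> * winding_number \<gamma> z * f z" if "\<gamma> \<in> set \<Gamma>" for \<gamma>
      using \<Gamma>[OF that] U that \<open>z \<notin> P\<close> by (intro contour_integral_difference_quotient[of _ U]) (auto simp: P_def)
    then show ?thesis
      unfolding Q_def C_def by (induction \<Gamma>) (simp_all add: ring_distribs)
  qed
  \<comment> \<open>The overlap of the two definitions: off the paths they agree wherever the total
    winding number vanishes, whether or not the point lies in \<open>U\<close>.\<close>
  have hC: "h z = C z" if "z \<notin> P" "(\<Sum>\<gamma>\<leftarrow>\<Gamma>. winding_number \<gamma> z) = 0" for z
    using QC that by (simp add: h_def)
  have "h field_differentiable at z" for z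
  proof (cases "z \<in> U")
    case True
    have "h holomorphic_on U"
      using holQ by (rule holomorphic_transform) (simp add: h_def)
    then show ?thesis
      using U(1) True holomorphic_on_imp_differentiable_at by blast
  next
    case False
    \<comment> \<open>A neighbourhood of \<open>z\<close> that may meet \<open>U\<close>. Each
      winding number is constant on it, so their sum stays 0 and \<open>h\<close> coincides with
      \<open>C\<close> there.\<close>
    define V where "V = (\<Inter>\<gamma>\<in>set \<Gamma>. {w. w \<notin> path_image \<gamma> \<and> winding_number \<gamma> w = winding_number \<gamma> z})"
    have "open V"
      unfolding V_def using \<Gamma>
      by (intro open_INT) (auto intro!: open_winding_number_levelsets simp: valid_path_imp_path)
    moreover have zV: "z \<in> V"
      using False P(2) by (auto simp: V_def P_def)
    moreover have VP: "V \<inter> P = {}"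
      by (auto simp: V_def P_def)
    moreover have "h w = C w" if "w \<in> V" for w
    proof (rule hC)
      show "w \<notin> P"
        using that VP by auto
      have "(\<Sum>\<gamma>\<leftarrow>\<Gamma>. winding_number \<gamma> w) = (\<Sum>\<gamma>\<leftarrow>\<Gamma>. winding_number \<gamma> z)"
        using that by (intro arg_cong[where f = sum_list] map_cong) (auto simp: V_def)
      then show "(\<Sum>\<gamma>\<leftarrow>\<Gamma>. winding_number \<gamma> w) = 0"
        using zero False by simp
    qed
    ultimately show ?thesis
      using holC holomorphic_on_imp_differentiable_at[of h V z]
      by (metis Int_commute compl_le_swap1 disjoint_eq_subset_Compl holomorphic_on_subset holomorphic_transform)
  qed
  then have "h holomorphic_on UNIV"
    by (simp add: holomorphic_on_def)
  \<comment> \<open>Far away from the cycle all winding numbers vanish, so \<open>h\<close> inherits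
    the limit 0 of \<open>C\<close> and Liouville's theorem applies.\<close>
  moreover have "\<forall>\<^sub>F z in at_infinity. C z = h z"
  proof -
    obtain R where R: "P \<subseteq> ball 0 R"
      using P(3) bounded_subset_ballD by metis
    have "h z = C z" if z: "norm z \<ge> R" for z
    proof (rule hC)
      show "z \<notin> P"
        using R z by auto
      have "winding_number \<gamma> z = 0" if "\<gamma> \<in> set \<Gamma>" for \<gamma>
        using that z R \<Gamma> by (intro winding_number_zero_outside[of _ "ball 0 R"]) (auto simp: valid_path_imp_path P_def)
      then have "map (\<lambda>\<gamma>. winding_number \<gamma> z) \<Gamma> = map (\<lambda>\<gamma>. 0) \<Gamma>"
        by auto
      then show "(\<Sum>\<gamma>\<leftarrow>\<Gamma>. winding_number \<gamma> z) = 0"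
        by (simp only: sum_list_0)
    qed
    then show ?thesis
      unfolding eventually_at_infinity by metis
  qed
  then have "(h \<longlongrightarrow> 0) at_infinity"
    using limC tendsto_cong by metis
  ultimately have "h z = 0"
    by (rule Liouville_weak_0)
  then show ?thesis
    using z by (simp add: h_def Q_def)
qed

text \<open>The preceding lemma is applied to \<open>(w - z) * f w\<close>, whose difference
  quotient at its zero \<open>z\<close> is \<open>f\<close> itself.\<close>

theorem Cauchy_theorem_cycle:
  assumes U: "open U" "f holomorphic_on U"
    and \<Gamma>: "\<And>\<gamma>. \<gamma> \<in> set \<Gamma> \<Longrightarrow> valid_path \<gamma> \<and> pathfinish \<gamma> = pathstart \<gamma> \<and> path_image \<gamma> \<subseteq> U"
    and zero: "\<And>z. z \<notin> U \<Longrightarrow> (\<Sum>\<gamma>\<leftarrow>\<Gamma>. winding_number \<gamma> z) = 0"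
  shows "(\<Sum>\<gamma>\<leftarrow>\<Gamma>. contour_integral \<gamma> f) = 0"
proof (cases "U = {}")
  case True
  then have "set \<Gamma> = {}"
    using \<Gamma> by fastforce
  then show ?thesis
    by simp
next
  case False
  then obtain z where z: "z \<in> U"
    by auto
  have hol: "(\<lambda>w. (w - z) * f w) holomorphic_on U"
    using U(2) by (intro holomorphic_intros)
  have "((\<lambda>w. (w - z) * f w) has_field_derivative f z) (at z)"
    using holomorphic_derivI[OF U(2,1) z] by (auto intro!: derivative_eq_intros)
  then have "difference_quotient (\<lambda>w. (w - z) * f w) z = f"
    by (auto simp: difference_quotient_def fun_eq_iff dest: DERIV_imp_deriv)
  then show ?thesis
    using Cauchy_cycle_difference_quotient[OF U(1) hol \<Gamma> zero z] by simp
qed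

section \<open>Contour integrals of vector-valued series\<close>

lemma bounded_linear_scaleC_left: "bounded_linear (\<lambda>c. c *\<^sub>C (x :: 'a::complex_normed_vector))"
  by (rule bounded_linear_intro[where K = "norm x"])
    (auto simp: scaleC_add_left norm_scaleC scaleR_conv_of_real simp flip: scaleC_scaleC scaleC_of_real)

lemmas scaleC_sum_right = linear_sum[OF bounded_linear.linear[OF bounded_linear_scaleC]]
lemmas scaleC_diff_right = linear_diff[OF bounded_linear.linear[OF bounded_linear_scaleC]]

lemma scaleC_zero_left [simp]: "0 *\<^sub>C (x :: 'a::complex_normed_vector) = 0"
  by (metis norm_eq_zero norm_scaleC mult_zero_left norm_zero)

text \<open>Primitives of the scalar coefficients are summed term by term. The majorant makes the
  series of derivatives converge uniformly; the primitives then have to converge at one point only,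
  which the normalisation \<open>p j a = 0\<close> at the centre provides.\<close>

lemma vector_series_primitive:
  fixes v :: "nat \<Rightarrow> 'b::complex_banach"
  assumes c: "\<And>j. c j holomorphic_on ball a e"
    and M: "\<And>j z. z \<in> ball a e \<Longrightarrow> norm (c j z) * norm (v j) \<le> M j" "summable M"
    and e: "0 < e"
  obtains P where "\<And>z. z \<in> ball a e \<Longrightarrow> (P has_derivative (\<lambda>h. h *\<^sub>C (\<Sum>j. c j z *\<^sub>C v j))) (at z)"
proof -
  have "\<exists>p. p a = 0 \<and> (\<forall>z\<in>ball a e. (p has_field_derivative c j z) (at z within ball a e))" for j
  proof -
    obtain p where p: "\<And>z. z \<in> ball a e \<Longrightarrow> (p has_field_derivative c j z) (at z within ball a e)"
      using holomorphic_convex_primitive'[OF convex_ball open_ball c] by blast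
    then have "((\<lambda>z. p z - p a) has_field_derivative c j z) (at z within ball a e)" if "z \<in> ball a e" for z
      using that by (auto intro!: derivative_eq_intros)
    then show ?thesis
      by (intro exI[of _ "\<lambda>z. p z - p a"]) auto
  qed
  then obtain p where p0: "\<And>j. p j a = 0"
    and p: "\<And>j z. z \<in> ball a e \<Longrightarrow> (p j has_field_derivative c j z) (at z within ball a e)"
    by metis
  define S where "S z = (\<Sum>j. c j z *\<^sub>C v j)" for z
  have unif: "uniform_limit (ball a e) (\<lambda>n z. \<Sum>j<n. c j z *\<^sub>C v j) S sequentially"
    unfolding S_def using M by (intro Weierstrass_m_test) (auto simp: norm_scaleC)
  have "\<exists>g. \<forall>z\<in>ball a e. (\<lambda>n. p n z *\<^sub>C v n) sums g z \<and> (g has_derivative (\<lambda>h. h *\<^sub>C S z)) (at z within ball a e)"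
  proof (rule has_derivative_series[where f' = "\<lambda>n z h. (c n z * h) *\<^sub>C v n" and x = a and l = 0])
    fix n z assume "z \<in> ball a e"
    then have "(p n has_derivative (*) (c n z)) (at z within ball a e)"
      using p by (simp add: has_field_derivative_def)
    then show "((\<lambda>z. p n z *\<^sub>C v n) has_derivative (\<lambda>h. (c n z * h) *\<^sub>C v n)) (at z within ball a e)"
      by (rule bounded_linear.has_derivative[OF bounded_linear_scaleC_left])
  next
    fix d :: real assume "0 < d"
    then have "\<forall>\<^sub>F n in sequentially. \<forall>z\<in>ball a e. dist (\<Sum>j<n. c j z *\<^sub>C v j) (S z) < d"
      using unif unfolding uniform_limit_iff by blast
    then show "\<forall>\<^sub>F n in sequentially. \<forall>z\<in>ball a e. \<forall>h. norm ((\<Sum>i<n. (c i z * h) *\<^sub>C v i) - h *\<^sub>C S z) \<le> d * norm h"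
    proof eventually_elim
      case (elim n)
      have "(\<Sum>i<n. (c i z * h) *\<^sub>C v i) - h *\<^sub>C S z = h *\<^sub>C ((\<Sum>i<n. c i z *\<^sub>C v i) - S z)" for z h
        by (simp add: scaleC_sum_right scaleC_diff_right scaleC_scaleC mult.commute)
      then show ?case
        using elim by (auto simp: norm_scaleC dist_norm mult.commute[of d] less_imp_le intro!: mult_left_mono)
    qed
  qed (use e p0 in simp_all)
  then obtain g where "\<And>z. z \<in> ball a e \<Longrightarrow> (g has_derivative (\<lambda>h. h *\<^sub>C S z)) (at z within ball a e)"
    by blast
  then show thesis
    by (intro that[of g]) (auto simp: S_def at_within_open[of _ "ball a e"])
qed

text \<open>Away from the finitely many corners the integrand is locally the derivative of
  \<open>P \<circ> \<gamma>\<close>. The fundamental theorem of calculus gives integrability on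
  short intervals, and these cover the whole.\<close>

lemma vector_contour_integrable:
  fixes F :: "complex \<Rightarrow> 'b::complex_banach"
  assumes \<gamma>: "valid_path \<gamma>"
    and prim: "\<And>z. z \<in> path_image \<gamma> \<Longrightarrow>
      \<exists>e>0. \<exists>P. \<forall>w\<in>ball z e. (P has_derivative (\<lambda>h. h *\<^sub>C F w)) (at w)"
  shows "(\<lambda>t. vector_derivative \<gamma> (at t within {0..1}) *\<^sub>C F (\<gamma> t)) integrable_on {0..1}" (is "?G integrable_on _")
proof -
  have cont: "continuous_on {0..1} \<gamma>"
    using \<gamma> by (simp add: valid_path_def piecewise_C1_differentiable_on_def)
  obtain S where S: "finite S" "\<gamma> C1_differentiable_on {0..1} - S"
    using \<gamma> by (auto simp: valid_path_def piecewise_C1_differentiable_on_def)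
  have "\<exists>d>0. \<forall>u v. x \<in> cbox u v \<and> cbox u v \<subseteq> ball x d \<and> cbox u v \<subseteq> cbox 0 1 \<longrightarrow> ?G integrable_on cbox u v"
    if x: "x \<in> cbox 0 1" for x
  proof -
    obtain e P where e: "0 < e" and P: "\<And>w. w \<in> ball (\<gamma> x) e \<Longrightarrow> (P has_derivative (\<lambda>h. h *\<^sub>C F w)) (at w)"
      using prim x by (metis cbox_interval image_eqI path_image_def)
    obtain d where d: "0 < d" "\<And>t. t \<in> {0..1} \<Longrightarrow> dist t x < d \<Longrightarrow> dist (\<gamma> t) (\<gamma> x) < e"
      using cont x e unfolding continuous_on_iff by (metis cbox_interval)
    show ?thesis
    proof (intro exI conjI allI impI)
      fix u v assume uv: "x \<in> cbox u v \<and> cbox u v \<subseteq> ball x d \<and> cbox u v \<subseteq> cbox 0 1"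
      then have "u \<le> v" and sub: "{u..v} \<subseteq> {0..1}" "{u..v} \<subseteq> ball x d"
        by auto
      have im: "\<gamma> t \<in> ball (\<gamma> x) e" if "t \<in> {u..v}" for t
        using that sub d(2)[of t] by (auto simp: subset_iff dist_commute)
      have "(?G has_integral (P \<circ> \<gamma>) v - (P \<circ> \<gamma>) u) {u..v}"
      proof (rule fundamental_theorem_of_calculus_interior_strong[OF S(1) \<open>u \<le> v\<close>])
        fix t assume t: "t \<in> {u<..<v} - S"
        then have t': "t \<in> {0..1}" "t \<in> {u..v}"
          using sub by auto
        have "\<gamma> differentiable at t"
          using S(2) t t' C1_differentiable_on_eq by blast
        then have D: "(\<gamma> has_vector_derivative vector_derivative \<gamma> (at t)) (at t)"
          using vector_derivative_works by blast
        then have "vector_derivative \<gamma> (at t within {0..1}) = vector_derivative \<gamma> (at t)"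
          by (intro vector_derivative_at_within_ivl) (use t' in auto)
        moreover have "((P \<circ> \<gamma>) has_derivative (\<lambda>h. h *\<^sub>C F (\<gamma> t)) \<circ> (\<lambda>h. h *\<^sub>R vector_derivative \<gamma> (at t))) (at t)"
          using D P[OF im[OF t'(2)]] unfolding has_vector_derivative_def by (rule diff_chain_at)
        ultimately show "((P \<circ> \<gamma>) has_vector_derivative ?G t) (at t)"
          by (simp add: has_vector_derivative_def o_def scaleR_conv_of_real scaleC_of_real flip: scaleC_scaleC)
      next
        have "continuous_on (ball (\<gamma> x) e) P"
          using P by (meson continuous_at_imp_continuous_on has_derivative_continuous)
        then show "continuous_on {u..v} (P \<circ> \<gamma>)"
          using im continuous_on_subset[OF cont sub(1)]
          by (intro continuous_on_compose) (auto intro: continuous_on_subset)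
      qed
      then show "?G integrable_on cbox u v"
        by auto
    qed (rule d(1))
  qed
  then have "?G integrable_on cbox 0 1"
    by (intro integrable_on_little_subintervals ballI)
  then show ?thesis
    by simp
qed

text \<open>For a coordinate functional \<open>\<phi>\<close> this reduces an operator-valued
  integral to a scalar one. Since \<open>bounded_linear\<close> means real linearity, complex
  homogeneity is a separate assumption.\<close>

lemma vector_contour_integral_bounded_linear:
  fixes F :: "complex \<Rightarrow> 'b::complex_banach" and \<phi> :: "'b \<Rightarrow> complex"
  assumes "(\<lambda>t. vector_derivative \<gamma> (at t within {0..1}) *\<^sub>C F (\<gamma> t)) integrable_on {0..1}"
    and \<phi>: "bounded_linear \<phi>" "\<And>c x. \<phi> (c *\<^sub>C x) = c * \<phi> x"
  shows "\<phi> (vector_contour_integral \<gamma> F) = contour_integral \<gamma> (\<lambda>z. \<phi> (F z))"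
proof -
  have "\<phi> (vector_contour_integral \<gamma> F) =
      integral {0..1} (\<lambda>t. \<phi> (vector_derivative \<gamma> (at t within {0..1}) *\<^sub>C F (\<gamma> t)))"
    unfolding vector_contour_integral_def using integral_linear[OF assms(1) \<phi>(1)] by (simp add: o_def)
  also have "\<dots> = contour_integral \<gamma> (\<lambda>z. \<phi> (F z))"
    by (simp add: \<phi>(2) contour_integral_def has_contour_integral_def contour_integrable_on_def integral_def
        integrable_on_def mult.commute)
  finally show ?thesis .
qed

section \<open>Laurent coefficients\<close>

lemma winding_number_circlepath_outside:
  assumes "norm (w - z) > r" "r > 0"
  shows "winding_number (circlepath z r) w = 0"
  using assms by (intro winding_number_zero_outside[of _ "cball z r"]) (auto simp: dist_norm norm_minus_commute)

text \<open>The circle of radius \<open>r\<close> and the reversed circle of radius \<open>s\<close>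
  form a cycle with winding number 0 about every point off the closed annulus between them, in
  whichever order the radii come.\<close>

lemma contour_integral_circlepath_annulus:
  assumes S: "open S" "g holomorphic_on S" and r: "0 < r" "0 < s"
    and sub: "\<And>z. min r s \<le> norm z \<Longrightarrow> norm z \<le> max r s \<Longrightarrow> z \<in> S"
  shows "contour_integral (circlepath 0 r) g = contour_integral (circlepath 0 s) g"
proof -
  have "(\<Sum>\<gamma>\<leftarrow>[circlepath 0 r, reversepath (circlepath 0 s)]. contour_integral \<gamma> g) = 0"
  proof (rule Cauchy_theorem_cycle[OF S])
    show "valid_path \<gamma> \<and> pathfinish \<gamma> = pathstart \<gamma> \<and> path_image \<gamma> \<subseteq> S"
      if "\<gamma> \<in> set [circlepath 0 r, reversepath (circlepath 0 s)]" for \<gamma>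
      using that r sub by auto
  next
    fix z assume "z \<notin> S"
    then consider "norm z < r" "norm z < s" | "norm z > r" "norm z > s"
      using sub[of z] by linarith
    then show "(\<Sum>\<gamma>\<leftarrow>[circlepath 0 r, reversepath (circlepath 0 s)]. winding_number \<gamma> z) = 0"
      by cases (use r in \<open>simp_all add: winding_number_reversepath winding_number_circlepath
          winding_number_circlepath_outside\<close>)
  qed
  then show ?thesis
    by (simp add: contour_integral_reversepath)
qed

text \<open>Adding the reversed circle to \<Gamma> gives index 1 - 1 = 0 on the closed unit disc and
  0 off \<open>U\<close>, so Cauchy's theorem applies on the difference. Hence the unspecified cycle
  in the functional calculus may be replaced by a circle.\<close>

lemma contour_integral_cycle_eq_circlepath:
  assumes \<Gamma>: "surrounds \<Gamma> (cball 0 1) U" and U: "open U" "cball 0 r \<subseteq> U" "1 < r"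
    and F: "F holomorphic_on U - cball 0 1"
  shows "(\<Sum>\<gamma>\<leftarrow>\<Gamma>. contour_integral \<gamma> F) = contour_integral (circlepath 0 r) F"
proof -
  have "(\<Sum>\<gamma>\<leftarrow>reversepath (circlepath 0 r) # \<Gamma>. contour_integral \<gamma> F) = 0"
  proof (rule Cauchy_theorem_cycle[OF _ F])
    show "open (U - cball 0 1)"
      using U(1) by blast
    show "valid_path \<gamma> \<and> pathfinish \<gamma> = pathstart \<gamma> \<and> path_image \<gamma> \<subseteq> U - cball 0 1"
      if "\<gamma> \<in> set (reversepath (circlepath 0 r) # \<Gamma>)" for \<gamma>
      using that \<Gamma> U by (auto simp: surrounds_def)
  next
    fix z assume z: "z \<notin> U - cball 0 1"
    show "(\<Sum>\<gamma>\<leftarrow>reversepath (circlepath 0 r) # \<Gamma>. winding_number \<gamma> z) = 0"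
    proof (cases "z \<in> cball 0 1")
      case True
      then show ?thesis
        using \<Gamma> U by (simp add: surrounds_def winding_number_reversepath winding_number_circlepath)
    next
      case False
      then have "z \<notin> U" "norm z > r"
        using z U by force+
      then show ?thesis
        using \<Gamma> U by (simp add: surrounds_def winding_number_reversepath winding_number_circlepath_outside)
    qed
  qed
  then show ?thesis
    by (simp add: contour_integral_reversepath)
qed

lemma contour_integral_circlepath_sums:
  assumes \<phi>: "\<And>j. continuous_on (sphere 0 r) (\<phi> j)"
    and M: "\<And>j z. norm z = r \<Longrightarrow> norm (\<phi> j z) \<le> M j" "summable M" and r: "0 < r"
  shows "(\<lambda>j. contour_integral (circlepath 0 r) (\<phi> j)) sums
    contour_integral (circlepath 0 r) (\<lambda>z. \<Sum>j. \<phi> j z)"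
proof -
  have int: "\<phi> j contour_integrable_on circlepath 0 r" for j
    using \<phi> r by (intro contour_integrable_continuous_circlepath) simp
  have "((\<lambda>n. contour_integral (circlepath 0 r) (\<lambda>z. \<Sum>j<n. \<phi> j z)) \<longlongrightarrow>
      contour_integral (circlepath 0 r) (\<lambda>z. \<Sum>j. \<phi> j z)) sequentially"
  proof (rule contour_integral_uniform_limit_circlepath(2))
    show "uniform_limit (sphere 0 r) (\<lambda>n z. \<Sum>j<n. \<phi> j z) (\<lambda>z. \<Sum>j. \<phi> j z) sequentially"
      using M by (intro Weierstrass_m_test) auto
  qed (use int r in \<open>auto intro!: always_eventually contour_integrable_sum\<close>)
  then show ?thesis
    using int by (simp add: sums_def contour_integral_sum)
qed

text \<open>The coefficient of z^k in the Laurent expansion about 0, written as the k-th Fourier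
  coefficient on the unit circle; it depends only on the values there.\<close>

definition laurent_coeff :: "(complex \<Rightarrow> complex) \<Rightarrow> int \<Rightarrow> complex"
  where "laurent_coeff g k = contour_integral (circlepath 0 1) (\<lambda>z. g z * z powi (- k - 1)) / (2 * pi * \<i>)"

text \<open>Invariant under inversion in the unit circle, so that one parameter governs the decay of
  the Laurent coefficients in both directions.\<close>

definition annulus :: "real \<Rightarrow> complex set"
  where "annulus \<rho> = {z. 1 / \<rho> < norm z \<and> norm z < \<rho>}"

lemma open_annulus: "open (annulus \<rho>)"
  unfolding annulus_def by (intro open_Collect_conj open_Collect_less continuous_intros)

lemma sphere_subset_annulus: "1 < \<rho> \<Longrightarrow> norm z = 1 \<Longrightarrow> z \<in> annulus \<rho>"
  by (simp add: annulus_def)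

lemma laurent_coeff_cong:
  assumes "\<And>z. norm z = 1 \<Longrightarrow> g z = h z"
  shows "laurent_coeff g = laurent_coeff h"
  using assms by (auto simp: laurent_coeff_def fun_eq_iff intro!: contour_integral_cong)

lemma laurent_coeff_eq:
  assumes g: "g holomorphic_on annulus \<rho>" and \<rho>: "1 < \<rho>" and r: "1 / \<rho> < r" "r < \<rho>"
  shows "laurent_coeff g k = contour_integral (circlepath 0 r) (\<lambda>z. g z * z powi (- k - 1)) / (2 * pi * \<i>)"
proof -
  have "0 < 1 / \<rho>" "1 / \<rho> < 1"
    using \<rho> by auto
  then have "0 < r"
    using r by linarith
  have "contour_integral (circlepath 0 1) (\<lambda>z. g z * z powi (- k - 1)) =
      contour_integral (circlepath 0 r) (\<lambda>z. g z * z powi (- k - 1))"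
  proof (rule contour_integral_circlepath_annulus[OF open_annulus[of \<rho>]])
    show "(\<lambda>z. g z * z powi (- k - 1)) holomorphic_on annulus \<rho>"
      using \<open>0 < 1 / \<rho>\<close> by (intro holomorphic_intros g) (auto simp: annulus_def)
    show "z \<in> annulus \<rho>" if "min 1 r \<le> norm z" "norm z \<le> max 1 r" for z
      using that \<open>1 / \<rho> < 1\<close> \<rho> r unfolding annulus_def by (simp only: mem_Collect_eq) linarith
  qed (use \<open>0 < r\<close> in auto)
  then show ?thesis
    by (simp add: laurent_coeff_def)
qed

text \<open>Cauchy's estimate on the circle of radius \<open>q\<close> for nonnegative
  \<open>k\<close> and of radius \<open>1 / q\<close> for negative \<open>k\<close>.\<close>

lemma norm_laurent_coeff_le:
  assumes g: "g holomorphic_on annulus \<rho>" and M: "\<And>z. z \<in> annulus \<rho> \<Longrightarrow> norm (g z) \<le> M"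
    and q: "1 < q" "q < \<rho>"
  shows "norm (laurent_coeff g k) \<le> M * (1 / q) ^ nat \<bar>k\<bar>"
proof -
  have bound: "norm (laurent_coeff g k) \<le> M * r powi (- k)" if r: "1 / \<rho> < r" "r < \<rho>" for r
  proof -
    have "0 < 1 / \<rho>"
      using q by auto
    then have "0 < r"
      using r by linarith
    have M0: "0 \<le> M"
      using M[of 1] q order_trans[OF norm_ge_zero] by (auto simp: annulus_def)
    have "continuous_on (sphere 0 r) (\<lambda>z. g z * z powi (- k - 1))"
      using \<open>0 < r\<close> r
      by (intro continuous_intros continuous_on_subset[OF holomorphic_on_imp_continuous_on[OF g]])
        (auto simp: annulus_def)
    then have "((\<lambda>z. g z * z powi (- k - 1)) has_contour_integral
        contour_integral (circlepath 0 r) (\<lambda>z. g z * z powi (- k - 1))) (circlepath 0 r)"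
      using \<open>0 < r\<close> by (intro has_contour_integral_integral contour_integrable_continuous_circlepath) simp
    then have "norm (contour_integral (circlepath 0 r) (\<lambda>z. g z * z powi (- k - 1))) \<le>
        (M * r powi (- k - 1)) * (2 * pi * r)"
      by (rule has_contour_integral_bound_circlepath)
        (use M0 \<open>0 < r\<close> r in \<open>auto simp: norm_mult norm_power_int annulus_def intro!: mult_right_mono M\<close>)
    also have "\<dots> = M * r powi (- k) * (2 * pi)"
      using \<open>0 < r\<close> by (simp add: power_int_diff)
    finally show ?thesis
      using q r by (simp add: laurent_coeff_eq[OF g] norm_divide norm_mult divide_simps)
  qed
  show ?thesis
  proof (cases "k \<ge> 0")
    case True
    have "1 / \<rho> < 1"
      using q by simp
    then have "norm (laurent_coeff g k) \<le> M * q powi (- k)"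
      using q by (intro bound) linarith+
    then show ?thesis
      using True by (auto simp: power_int_def inverse_eq_divide split: if_splits)
  next
    case False
    have "1 / q < 1" "1 / \<rho> < 1 / q"
      using q by (auto simp: frac_less2)
    then have "norm (laurent_coeff g k) \<le> M * (1 / q) powi (- k)"
      using q by (intro bound) linarith+
    then show ?thesis
      using False by (simp add: power_int_def)
  qed
qed

text \<open>The vanishing at negative indices is what makes the Toeplitz matrix of a function
  holomorphic in the disc upper triangular.\<close>

lemma laurent_coeff_holomorphic:
  assumes h: "h holomorphic_on ball 0 \<rho>" "1 < \<rho>"
  shows "laurent_coeff h (int j) = (deriv ^^ j) h 0 / fact j" and "k < 0 \<Longrightarrow> laurent_coeff h k = 0"
proof -
  have cont: "continuous_on (cball 0 1) h"
    using h by (intro continuous_on_subset[OF holomorphic_on_imp_continuous_on[OF h(1)]]) auto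
  have hol: "h holomorphic_on ball 0 1"
    using h by (intro holomorphic_on_subset[OF h(1)]) auto
  have "((\<lambda>u. h u / (u - 0) ^ Suc j) has_contour_integral 2 * pi * \<i> / fact j * (deriv ^^ j) h 0) (circlepath 0 1)"
    using Cauchy_has_contour_integral_higher_derivative_circlepath[OF cont hol, of 0 j] by simp
  then have *: "contour_integral (circlepath 0 1) (\<lambda>u. h u / u ^ Suc j) = 2 * pi * \<i> / fact j * (deriv ^^ j) h 0"
    by (simp add: contour_integral_unique)
  have "contour_integral (circlepath 0 1) (\<lambda>u. h u / u ^ Suc j) =
      contour_integral (circlepath 0 1) (\<lambda>z. h z * z powi (- int j - 1))"
    by (intro contour_integral_cong) (auto simp: power_int_def nat_add_distrib field_simps)
  from this[symmetric] show "laurent_coeff h (int j) = (deriv ^^ j) h 0 / fact j"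
    unfolding laurent_coeff_def * by simp
  show "laurent_coeff h k = 0" if "k < 0"
  proof -
    have "((\<lambda>z. h z * z ^ nat (- k - 1)) has_contour_integral 0) (circlepath 0 1)"
      using h(2)
      by (intro Cauchy_theorem_convex_simple[of _ "ball 0 \<rho>"] holomorphic_intros h(1)) auto
    then have "contour_integral (circlepath 0 1) (\<lambda>z. h z * z powi (- k - 1)) = 0"
      using that by (simp add: power_int_def contour_integral_unique)
    then show ?thesis
      by (simp add: laurent_coeff_def)
  qed
qed

text \<open>The Cauchy product is one-sided because \<open>h\<close> has a Taylor series; this
  converges absolutely on the unit circle and may be integrated against \<open>g\<close> term by
  term.\<close>

lemma laurent_coeff_mult_sums:
  assumes h: "h holomorphic_on ball 0 \<rho>" and g: "g holomorphic_on annulus \<rho>" and \<rho>: "1 < \<rho>"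
  shows "(\<lambda>j. laurent_coeff h (int j) * laurent_coeff g (k - int j)) sums laurent_coeff (\<lambda>z. h z * g z) k"
proof -
  define \<phi> where "\<phi> j z = laurent_coeff h (int j) * (g z * z powi (- (k - int j) - 1))" for j z
  have h_sums: "(\<lambda>j. laurent_coeff h (int j) * z ^ j) sums h z" if "norm z < \<rho>" for z
    using holomorphic_power_series[OF h, of z] that laurent_coeff_holomorphic(1)[OF h \<rho>] by simp
  have contg: "continuous_on (sphere 0 1) g"
    using \<rho> by (intro continuous_on_subset[OF holomorphic_on_imp_continuous_on[OF g]])
      (auto intro: sphere_subset_annulus)
  then have "compact (g ` sphere 0 1)"
    by (simp add: compact_continuous_image)
  then obtain D where D: "\<And>z. norm z = 1 \<Longrightarrow> norm (g z) \<le> D"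
    using compact_imp_bounded bounded_pos by (metis imageI mem_sphere_0)
  have "(\<lambda>j. contour_integral (circlepath 0 1) (\<phi> j)) sums contour_integral (circlepath 0 1) (\<lambda>z. \<Sum>j. \<phi> j z)"
  proof (rule contour_integral_circlepath_sums)
    show "continuous_on (sphere 0 1) (\<phi> j)" for j
      unfolding \<phi>_def by (intro continuous_intros contg) auto
    show "norm (\<phi> j z) \<le> norm (laurent_coeff h (int j)) * D" if "norm z = 1" for j z
      using that by (auto simp: \<phi>_def norm_mult norm_power_int intro!: mult_left_mono D)
    \<comment> \<open>Convergence at the point (1 + \<rho>)/2, beyond the unit circle but inside the
      disc, forces absolute convergence at 1.\<close>
    have "summable (\<lambda>j. norm (laurent_coeff h (int j) * 1 ^ j))"
    proof (rule powser_insidea)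
      show "summable (\<lambda>j. laurent_coeff h (int j) * of_real ((1 + \<rho>) / 2) ^ j)"
        using \<rho> by (intro sums_summable[OF h_sums]) (simp only: norm_of_real; simp)
    qed (use \<rho> in \<open>simp only: norm_of_real; simp\<close>)
    then show "summable (\<lambda>j. norm (laurent_coeff h (int j)) * D)"
      by (intro summable_mult2) simp
  qed simp
  moreover have "contour_integral (circlepath 0 1) (\<lambda>z. \<Sum>j. \<phi> j z) =
      contour_integral (circlepath 0 1) (\<lambda>z. h z * g z * z powi (- k - 1))"
  proof (intro contour_integral_cong refl)
    fix z :: complex assume "z \<in> path_image (circlepath 0 1)"
    then have z: "norm z = 1"
      by simp
    then have "z \<noteq> 0"
      by auto
    then have "\<phi> j z = laurent_coeff h (int j) * z ^ j * (g z * z powi (- k - 1))" for j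
      using power_int_add[of z "int j" "- k - 1"] by (simp add: \<phi>_def algebra_simps)
    moreover have "(\<lambda>j. laurent_coeff h (int j) * z ^ j * (g z * z powi (- k - 1))) sums
        (h z * (g z * z powi (- k - 1)))"
      using h_sums[of z] z \<rho> by (intro sums_mult2) simp
    ultimately show "(\<Sum>j. \<phi> j z) = h z * g z * z powi (- k - 1)"
      by (simp add: sums_iff mult.assoc)
  qed
  ultimately have "(\<lambda>j. contour_integral (circlepath 0 1) (\<phi> j) / (2 * pi * \<i>)) sums laurent_coeff (\<lambda>z. h z * g z) k"
    unfolding laurent_coeff_def by (intro sums_divide) simp
  moreover have "contour_integral (circlepath 0 1) (\<phi> j) / (2 * pi * \<i>) =
      laurent_coeff h (int j) * laurent_coeff g (k - int j)" for j
  proof -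
    have "(\<lambda>z. g z * z powi (- (k - int j) - 1)) contour_integrable_on circlepath 0 1"
      by (intro contour_integrable_continuous_circlepath continuous_intros) (auto intro!: contg)
    from contour_integral_lmul[OF this] show ?thesis
      unfolding \<phi>_def
      by (simp add: laurent_coeff_def[of g])
  qed
  ultimately show ?thesis
    by simp
qed

section \<open>The functional calculus of the backward shift\<close>

lemma apply_Bcontfun_nat:
  fixes g :: "nat \<Rightarrow> 'a::real_normed_vector"
  assumes "\<And>n. norm (g n) \<le> C"
  shows "apply_bcontfun (Bcontfun g) = g"
  using assms by (intro Bcontfun_inverse bcontfun_normI) auto

section \<open>Powers, resolvent and spectrum of the backward shift\<close>

primrec shift_power :: "nat \<Rightarrow> linf \<Rightarrow>\<^sub>L linf" where
  "shift_power 0 = id_blinfun"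
| "shift_power (Suc j) = backward_shift o\<^sub>L shift_power j"

lemma shift_power_apply: "apply_bcontfun (shift_power j x) m = apply_bcontfun x (m + j)"
  by (induction j arbitrary: m) simp_all

lemma norm_shift_power_le: "norm (shift_power j) \<le> 1"
  by (intro norm_blinfun_bound norm_bound) (simp_all add: shift_power_apply norm_bounded)

lemma bounded_linear_coordinate:
  fixes y :: "'a::real_normed_vector"
  shows "bounded_linear (\<lambda>A :: 'a \<Rightarrow>\<^sub>L linf. apply_bcontfun (blinfun_apply A y) m)"
proof (rule bounded_linear_intro[where K = "norm y"])
  show "norm (apply_bcontfun (blinfun_apply A y) m) \<le> norm A * norm y" for A :: "'a \<Rightarrow>\<^sub>L linf"
    using norm_bounded[of "A y" m] norm_blinfun[of A y] by linarith
qed (simp_all add: blinfun.add_left blinfun.scaleR_left)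

text \<open>The Neumann series of the inverse of l - B. It converges for |l| > 1 because the powers
  of B are contractions.\<close>

definition shift_resolvent :: "complex \<Rightarrow> linf \<Rightarrow>\<^sub>L linf"
  where "shift_resolvent l = (\<Sum>j. inverse (l ^ Suc j) *\<^sub>C shift_power j)"

lemma summable_shift_resolvent:
  assumes "1 < norm l"
  shows "summable (\<lambda>j. inverse (l ^ Suc j) *\<^sub>C shift_power j)"
proof (rule summable_comparison_test')
  have "inverse (norm l) < 1"
    using assms by (simp add: inverse_less_1_iff)
  then show "summable (\<lambda>j. inverse (norm l) ^ j)"
    by (intro summable_geometric) simp
  show "norm (inverse (l ^ Suc j) *\<^sub>C shift_power j) \<le> inverse (norm l) ^ j" if "j \<ge> 0" for j
  proof -
    have "inverse (norm l) ^ Suc j * norm (shift_power j) \<le> inverse (norm l) ^ j * 1"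
      using assms norm_shift_power_le[of j] by (intro mult_mono power_decreasing) (auto simp: inverse_le_1_iff)
    then show ?thesis
      by (simp add: norm_scaleC norm_inverse norm_power norm_mult power_inverse)
  qed
qed

lemma shift_resolvent_sums:
  assumes "1 < norm l"
  shows "(\<lambda>j. inverse (l ^ Suc j) * apply_bcontfun x (m + j)) sums apply_bcontfun (shift_resolvent l x) m"
  using bounded_linear.sums[OF bounded_linear_coordinate summable_sums[OF summable_shift_resolvent[OF assms]], of x m]
  by (simp add: shift_resolvent_def shift_power_apply scaleC_complex_def)

text \<open>Multiplying the Neumann series by \<open>l\<close> shifts its index by one, which gives
  the right inverse. The left inverse follows since the series commutes with B and with
  \<open>l\<close>.\<close>

lemma is_resolvent_shift_resolvent:
  assumes l: "1 < norm l"
  shows "is_resolvent backward_shift l (shift_resolvent l)"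
proof -
  have l0: "l \<noteq> 0"
    using l by auto
  have comm: "shift_resolvent l (backward_shift x) = backward_shift (shift_resolvent l x)" for x
  proof (rule bcontfun_eqI)
    show "apply_bcontfun (shift_resolvent l (backward_shift x)) m =
        apply_bcontfun (backward_shift (shift_resolvent l x)) m" for m
      using shift_resolvent_sums[OF l, of "backward_shift x" m] shift_resolvent_sums[OF l, of x "Suc m"]
      by (simp add: sums_unique2)
  qed
  have right: "l *\<^sub>C shift_resolvent l x - backward_shift (shift_resolvent l x) = x" for x
  proof (rule bcontfun_eqI)
    fix m
    have "(\<lambda>j. l * (inverse (l ^ Suc j) * apply_bcontfun x (m + j))) sums (l * apply_bcontfun (shift_resolvent l x) m)"
      by (intro sums_mult shift_resolvent_sums l)
    then have "(\<lambda>j. inverse (l ^ j) * apply_bcontfun x (m + j)) sums (l * apply_bcontfun (shift_resolvent l x) m)"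
      using l0 by (simp add: field_simps)
    then have "(\<lambda>j. inverse (l ^ Suc j) * apply_bcontfun x (m + Suc j)) sums
        (l * apply_bcontfun (shift_resolvent l x) m - apply_bcontfun x m)"
      by (subst sums_Suc_iff) simp
    with shift_resolvent_sums[OF l, of x "Suc m"]
    have "apply_bcontfun (shift_resolvent l x) (Suc m) = l * apply_bcontfun (shift_resolvent l x) m - apply_bcontfun x m"
      by (simp add: sums_unique2)
    then show "apply_bcontfun (l *\<^sub>C shift_resolvent l x - backward_shift (shift_resolvent l x)) m = apply_bcontfun x m"
      by (simp add: scaleC_complex_def)
  qed
  \<comment> \<open>The operator type carries real linearity only, so complex homogeneity is
    verified on the entries.\<close>
  have "shift_resolvent l (l *\<^sub>C x) = l *\<^sub>C shift_resolvent l x" for x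
  proof (rule bcontfun_eqI)
    fix m
    have "(\<lambda>j. l * (inverse (l ^ Suc j) * apply_bcontfun x (m + j))) sums (l * apply_bcontfun (shift_resolvent l x) m)"
      by (intro sums_mult shift_resolvent_sums l)
    then show "apply_bcontfun (shift_resolvent l (l *\<^sub>C x)) m = apply_bcontfun (l *\<^sub>C shift_resolvent l x) m"
      using shift_resolvent_sums[OF l, of "l *\<^sub>C x" m]
      by (simp add: scaleC_complex_def mult.left_commute sums_unique2)
  qed
  then show ?thesis
    using right comm
    by (auto simp: is_resolvent_def blinfun.diff_left blinfun.diff_right intro!: blinfun_eqI)
qed

lemma resolvent_backward_shift:
  assumes "1 < norm l"
  shows "resolvent backward_shift l = shift_resolvent l"
  unfolding resolvent_def
proof (rule the_equality)
  show res: "is_resolvent backward_shift l (shift_resolvent l)"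
    by (rule is_resolvent_shift_resolvent[OF assms])
  fix R assume R: "is_resolvent backward_shift l R"
  have "R x = shift_resolvent l x" for x
  proof -
    have "x = (l *\<^sub>C id_blinfun - backward_shift) (shift_resolvent l x)"
      using res unfolding is_resolvent_def by (metis blinfun_apply_blinfun_compose blinfun_apply_id_blinfun)
    moreover have "R ((l *\<^sub>C id_blinfun - backward_shift) z) = z" for z
      using R unfolding is_resolvent_def by (metis blinfun_apply_blinfun_compose blinfun_apply_id_blinfun)
    ultimately show ?thesis
      by metis
  qed
  then show "R = shift_resolvent l"
    by (rule blinfun_eqI)
qed

text \<open>An eigenvector of the backward shift for the eigenvalue \<open>l\<close>. The sequence
  is bounded, and the value meaningful, only for |l| \<le> 1.\<close>

definition geometric_seq :: "complex \<Rightarrow> linf"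
  where "geometric_seq l = Bcontfun (\<lambda>m. l ^ m)"

lemma geometric_seq_apply:
  assumes "norm l \<le> 1"
  shows "apply_bcontfun (geometric_seq l) m = l ^ m"
  using apply_Bcontfun_nat[of "\<lambda>m. l ^ m" 1] assms
  by (simp add: geometric_seq_def norm_power power_le_one)

text \<open>On the closed disc, the circle included, the geometric sequence is a nonzero element of
  the kernel of l - B; outside, the Neumann series converges.\<close>

lemma spectrum_backward_shift: "spectrum backward_shift = cball 0 1"
proof -
  have "\<not> is_resolvent backward_shift l R" if l: "norm l \<le> 1" for l R
  proof
    assume R: "is_resolvent backward_shift l R"
    have "(l *\<^sub>C id_blinfun - backward_shift) (geometric_seq l) = 0"
      by (rule bcontfun_eqI) (simp add: blinfun.diff_left geometric_seq_apply[OF l] scaleC_complex_def)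
    then have "geometric_seq l = 0"
      using R unfolding is_resolvent_def
      by (metis blinfun.zero_right blinfun_apply_blinfun_compose blinfun_apply_id_blinfun)
    then show False
      using geometric_seq_apply[OF l, of 0] by simp
  qed
  then show ?thesis
    using is_resolvent_shift_resolvent by (auto simp: spectrum_def) (metis linorder_not_le)
qed

text \<open>Shows that the \<open>SOME\<close> in \<open>holomorphic_calculus\<close> does choose a
  contour surrounding the spectrum.\<close>

lemma surrounds_circlepath:
  assumes "cball 0 r \<subseteq> U" "1 < r"
  shows "surrounds [circlepath 0 r] (cball 0 1) U"
proof -
  have "winding_number (circlepath 0 r) z = 0" if "z \<notin> U" for z
    using assms that by (intro winding_number_circlepath_outside) (auto simp: subset_iff not_le)
  then show ?thesis
    using assms by (auto simp: surrounds_def winding_number_circlepath)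
qed

text \<open>The Neumann series times \<open>f\<close> has a uniform geometric majorant on a small
  disc about each point of the path, hence a local primitive.\<close>

lemma shift_resolvent_contour_integrable:
  assumes U: "open U" "f holomorphic_on U" and \<gamma>: "valid_path \<gamma>" "path_image \<gamma> \<subseteq> U - cball 0 1"
  shows "(\<lambda>t. vector_derivative \<gamma> (at t within {0..1}) *\<^sub>C (f (\<gamma> t) *\<^sub>C resolvent backward_shift (\<gamma> t)))
    integrable_on {0..1}"
proof (rule vector_contour_integrable[OF \<gamma>(1)])
  fix z assume z: "z \<in> path_image \<gamma>"
  have "open (U - cball 0 1)"
    using U(1) by blast
  then obtain e where e: "0 < e" "cball z e \<subseteq> U - cball 0 1"
    using z \<gamma>(2) open_contains_cball by blast
  have sub: "ball z e \<subseteq> U - cball 0 1"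
    using e(2) ball_subset_cball by blast
  have cont: "continuous_on (cball z e) f"
    using e(2) by (intro continuous_on_subset[OF holomorphic_on_imp_continuous_on[OF U(2)]]) auto
  then have "compact (f ` cball z e)"
    by (simp add: compact_continuous_image)
  then obtain D where D: "\<And>w. w \<in> cball z e \<Longrightarrow> norm (f w) \<le> D" "0 < D"
    using compact_imp_bounded bounded_pos by (metis imageI)
  have "compact (norm ` cball z e)"
    by (intro compact_continuous_image continuous_intros) auto
  then obtain w0 where w0: "w0 \<in> cball z e" "\<And>w. w \<in> cball z e \<Longrightarrow> norm w0 \<le> norm w"
    using compact_attains_inf[of "norm ` cball z e"] e(1) by force
  \<comment> \<open>The ratio of the majorant: \<open>w0\<close> has the least modulus on the closed
    disc, and this exceeds 1, so \<open>q < 1\<close> bounds 1/|w| uniformly.\<close>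
  define q where "q = inverse (norm w0)"
  have "1 < norm w0"
    using w0(1) e(2) by auto
  then have q: "0 < q" "q < 1"
    by (auto simp: q_def inverse_less_1_iff)
  have le_q: "inverse (norm w) \<le> q" if "w \<in> cball z e" for w
    unfolding q_def using w0(2)[OF that] \<open>1 < norm w0\<close> by (intro le_imp_inverse_le) auto
  obtain P where P: "\<And>w. w \<in> ball z e \<Longrightarrow>
      (P has_derivative (\<lambda>h. h *\<^sub>C (\<Sum>j. (f w * inverse (w ^ Suc j)) *\<^sub>C shift_power j))) (at w)"
  proof (rule vector_series_primitive[of "\<lambda>j w. f w * inverse (w ^ Suc j)" z e shift_power "\<lambda>j. D * q ^ Suc j"])
    show "(\<lambda>w. f w * inverse (w ^ Suc j)) holomorphic_on ball z e" for j
    proof -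
      have "w \<noteq> 0" if "w \<in> ball z e" for w
        using subsetD[OF sub that] by auto
      then show ?thesis
        using sub by (intro holomorphic_intros holomorphic_on_subset[OF U(2)]) (blast, simp)
    qed
    show "norm (f w * inverse (w ^ Suc j)) * norm (shift_power j) \<le> D * q ^ Suc j" if "w \<in> ball z e" for j w
    proof -
      have "norm (f w * inverse (w ^ Suc j)) \<le> D * q ^ Suc j"
        unfolding norm_mult norm_inverse norm_power power_inverse[symmetric]
        using that D q by (intro mult_mono power_mono le_q) auto
      from mult_mono[OF this norm_shift_power_le[of j]] show ?thesis
        using D q by auto
    qed
    show "summable (\<lambda>j. D * q ^ Suc j)"
      using q by (intro summable_mult) (simp add: summable_Suc_iff)
  qed (use e in auto)
  have eq: "f w *\<^sub>C resolvent backward_shift w = (\<Sum>j. (f w * inverse (w ^ Suc j)) *\<^sub>C shift_power j)"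
    if "w \<in> ball z e" for w
  proof -
    have "1 < norm w"
      using subsetD[OF sub that] by simp
    then show ?thesis
      unfolding resolvent_backward_shift[OF \<open>1 < norm w\<close>] shift_resolvent_def
      using bounded_linear.suminf[OF bounded_linear_scaleC summable_shift_resolvent, of w "f w"]
      by (simp add: scaleC_scaleC)
  qed
  show "\<exists>e>0. \<exists>P. \<forall>w\<in>ball z e. (P has_derivative (\<lambda>h. h *\<^sub>C (f w *\<^sub>C resolvent backward_shift w))) (at w)"
    by (intro exI[of _ e] conjI exI[of _ P] ballI e(1)) (simp only: eq P)
qed

text \<open>The substitution u = 1/l turns an entry of the Neumann series into \<open>u\<close>
  times a power series with bounded coefficients on the unit disc.\<close>

lemma shift_resolvent_coordinate_holomorphic:
  "(\<lambda>l. apply_bcontfun (shift_resolvent l y) m) holomorphic_on - cball 0 1"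
proof -
  define g where "g u = (\<Sum>j. apply_bcontfun y (m + j) * u ^ j)" for u
  have g_sums: "(\<lambda>j. apply_bcontfun y (m + j) * u ^ j) sums g u" if "norm u < 1" for u
    unfolding g_def
  proof (rule summable_sums, rule summable_comparison_test')
    show "summable (\<lambda>j. norm y * norm u ^ j)"
      using that by (intro summable_mult summable_geometric) simp
    show "norm (apply_bcontfun y (m + j) * u ^ j) \<le> norm y * norm u ^ j" if "j \<ge> 0" for j
      by (auto simp: norm_mult norm_power intro!: mult_right_mono norm_bounded)
  qed
  have "g holomorphic_on ball 0 1"
    using g_sums by (intro power_series_holomorphic[where a = "\<lambda>j. apply_bcontfun y (m + j)"]) simp
  moreover have "inverse l \<in> ball 0 1" if "l \<in> - cball 0 1" for l :: complex
    using that by (auto simp: norm_inverse inverse_less_1_iff)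
  ultimately have "(g \<circ> inverse) holomorphic_on - cball 0 1"
    by (intro holomorphic_on_compose_gen[of _ _ _ "ball 0 1"] holomorphic_intros) auto
  then have "(\<lambda>l. inverse l * (g \<circ> inverse) l) holomorphic_on - cball 0 1"
    by (rule holomorphic_on_mult[rotated]) (auto intro!: holomorphic_intros)
  then show ?thesis
  proof (rule holomorphic_transform)
    fix l :: complex assume "l \<in> - cball 0 1"
    then have l: "1 < norm l" "norm (inverse l) < 1"
      by (auto simp: norm_inverse inverse_less_1_iff)
    have "(\<lambda>j. inverse l * (apply_bcontfun y (m + j) * inverse l ^ j)) sums (inverse l * g (inverse l))"
      by (intro sums_mult g_sums l)
    then have "(\<lambda>j. inverse (l ^ Suc j) * apply_bcontfun y (m + j)) sums (inverse l * g (inverse l))"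
      by (simp add: power_inverse mult_ac)
    then show "inverse l * (g \<circ> inverse) l = apply_bcontfun (shift_resolvent l y) m"
      using shift_resolvent_sums[OF l(1), of y m] sums_unique2 by fastforce
  qed
qed

text \<open>Through the functional \<open>\<phi>\<close> the integral over the chosen cycle becomes
  scalar and moves to a circle of radius \<open>r > 1\<close>. There the Neumann series is
  integrated term by term, and its j-th term yields the j-th Laurent coefficient of
  \<open>f\<close>.\<close>

theorem holomorphic_calculus_backward_shift_sums:
  assumes U: "open U" "f holomorphic_on U" and \<rho>: "1 < \<rho>" "ball 0 \<rho> \<subseteq> U"
  shows "(\<lambda>j. laurent_coeff f (int j) * apply_bcontfun y (m + j)) sums
    apply_bcontfun (holomorphic_calculus U f backward_shift y) m"
proof -
  obtain r where r: "1 < r" "r < \<rho>"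
    using \<rho>(1) dense by blast
  then have rU: "cball 0 r \<subseteq> U"
    using \<rho>(2) by auto
  define \<Gamma> where "\<Gamma> = (SOME \<Gamma>. surrounds \<Gamma> (spectrum backward_shift) U)"
  have \<Gamma>: "surrounds \<Gamma> (cball 0 1) U"
    using someI[of "\<lambda>\<Gamma>. surrounds \<Gamma> (spectrum backward_shift) U"] surrounds_circlepath[OF rU r(1)]
    by (auto simp: \<Gamma>_def spectrum_backward_shift)
  define \<phi> where "\<phi> A = apply_bcontfun (blinfun_apply A y) m" for A :: "linf \<Rightarrow>\<^sub>L linf"
  have \<phi>: "bounded_linear \<phi>"
    unfolding \<phi>_def by (rule bounded_linear_coordinate)
  have \<phi>C: "\<phi> (c *\<^sub>C A) = c * \<phi> A" for c A
    by (simp add: \<phi>_def scaleC_complex_def)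
  have \<phi>_sum: "\<phi> (\<Sum>\<gamma>\<leftarrow>\<Delta>. X \<gamma>) = (\<Sum>\<gamma>\<leftarrow>\<Delta>. \<phi> (X \<gamma>))" for X and \<Delta> :: "(real \<Rightarrow> complex) list"
    by (induction \<Delta>) (auto simp: \<phi>_def blinfun.add_left)
  have "\<phi> (vector_contour_integral \<gamma> (\<lambda>l. f l *\<^sub>C resolvent backward_shift l)) =
      contour_integral \<gamma> (\<lambda>l. f l * \<phi> (shift_resolvent l))" if "\<gamma> \<in> set \<Gamma>" for \<gamma>
  proof -
    have \<gamma>: "valid_path \<gamma>" "path_image \<gamma> \<subseteq> U - cball 0 1"
      using \<Gamma> that by (auto simp: surrounds_def)
    have "\<phi> (vector_contour_integral \<gamma> (\<lambda>l. f l *\<^sub>C resolvent backward_shift l)) =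
        contour_integral \<gamma> (\<lambda>l. \<phi> (f l *\<^sub>C resolvent backward_shift l))"
      by (rule vector_contour_integral_bounded_linear[OF shift_resolvent_contour_integrable[OF U \<gamma>] \<phi> \<phi>C])
    also have "\<dots> = contour_integral \<gamma> (\<lambda>l. f l * \<phi> (shift_resolvent l))"
    proof (intro contour_integral_cong refl)
      fix l assume "l \<in> path_image \<gamma>"
      then have "1 < norm l"
        using \<gamma>(2) by auto
      then show "\<phi> (f l *\<^sub>C resolvent backward_shift l) = f l * \<phi> (shift_resolvent l)"
        by (simp add: \<phi>C resolvent_backward_shift)
    qed
    finally show ?thesis .
  qed
  then have "\<phi> (holomorphic_calculus U f backward_shift) =
      (\<Sum>\<gamma>\<leftarrow>\<Gamma>. contour_integral \<gamma> (\<lambda>l. f l * \<phi> (shift_resolvent l))) / (2 * pi * \<i>)"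
    unfolding holomorphic_calculus_def Let_def \<Gamma>_def[symmetric] \<phi>C \<phi>_sum
    by (simp cong: map_cong)
  also have "(\<Sum>\<gamma>\<leftarrow>\<Gamma>. contour_integral \<gamma> (\<lambda>l. f l * \<phi> (shift_resolvent l))) =
      contour_integral (circlepath 0 r) (\<lambda>l. f l * \<phi> (shift_resolvent l))"
    unfolding \<phi>_def
    by (intro contour_integral_cycle_eq_circlepath[OF \<Gamma> U(1) rU r(1)] holomorphic_intros
        holomorphic_on_subset[OF U(2)] holomorphic_on_subset[OF shift_resolvent_coordinate_holomorphic]) auto
  finally have calc: "\<phi> (holomorphic_calculus U f backward_shift) =
      contour_integral (circlepath 0 r) (\<lambda>l. f l * \<phi> (shift_resolvent l)) / (2 * pi * \<i>)" .
  define \<psi> where "\<psi> j l = f l * (inverse (l ^ Suc j) * apply_bcontfun y (m + j))" for j l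
  have cont: "continuous_on (sphere 0 r) f"
    using rU by (intro continuous_on_subset[OF holomorphic_on_imp_continuous_on[OF U(2)]]) auto
  then have "compact (f ` sphere 0 r)"
    by (simp add: compact_continuous_image)
  then obtain D where D: "\<And>l. norm l = r \<Longrightarrow> norm (f l) \<le> D" "0 < D"
    using compact_imp_bounded bounded_pos by (metis imageI mem_sphere_0)
  have "(\<lambda>j. contour_integral (circlepath 0 r) (\<psi> j)) sums
      contour_integral (circlepath 0 r) (\<lambda>l. \<Sum>j. \<psi> j l)"
  proof (rule contour_integral_circlepath_sums)
    show "continuous_on (sphere 0 r) (\<psi> j)" for j
      unfolding \<psi>_def using r by (intro continuous_intros cont) auto
    show "norm (\<psi> j l) \<le> D * (inverse r ^ Suc j * norm y)" if "norm l = r" for j l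
      unfolding \<psi>_def norm_mult norm_inverse norm_power power_inverse[symmetric] that
      using that r D by (intro mult_mono norm_bounded) auto
    show "summable (\<lambda>j. D * (inverse r ^ Suc j * norm y))"
      using r by (intro summable_mult summable_mult2) (simp add: summable_Suc_iff inverse_less_1_iff)
  qed (use r in auto)
  moreover have "contour_integral (circlepath 0 r) (\<lambda>l. \<Sum>j. \<psi> j l) =
      contour_integral (circlepath 0 r) (\<lambda>l. f l * \<phi> (shift_resolvent l))"
  proof (intro contour_integral_cong refl)
    fix l assume "l \<in> path_image (circlepath 0 r)"
    then have "1 < norm l"
      using r by simp
    then have "(\<lambda>j. \<psi> j l) sums (f l * \<phi> (shift_resolvent l))"
      unfolding \<psi>_def \<phi>_def by (intro sums_mult shift_resolvent_sums)
    then show "(\<Sum>j. \<psi> j l) = f l * \<phi> (shift_resolvent l)"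
      by (rule sums_unique[symmetric])
  qed
  ultimately have "(\<lambda>j. contour_integral (circlepath 0 r) (\<psi> j) / (2 * pi * \<i>)) sums
      \<phi> (holomorphic_calculus U f backward_shift)"
    unfolding calc by (intro sums_divide) simp
  moreover have "contour_integral (circlepath 0 r) (\<psi> j) / (2 * pi * \<i>) =
      laurent_coeff f (int j) * apply_bcontfun y (m + j)" for j
  proof -
    have hol: "f holomorphic_on annulus \<rho>"
      using \<rho>(2) by (intro holomorphic_on_subset[OF U(2)]) (auto simp: annulus_def)
    have "1 / \<rho> < 1"
      using \<rho>(1) by simp
    then have "1 / \<rho> < r"
      using r(1) by linarith
    have "contour_integral (circlepath 0 r) (\<psi> j) =
        contour_integral (circlepath 0 r) (\<lambda>l. apply_bcontfun y (m + j) * (f l * l powi (- int j - 1)))"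
      unfolding \<psi>_def
      by (intro contour_integral_cong refl)
        (use r in \<open>auto simp: power_int_def nat_add_distrib power_inverse mult_ac\<close>)
    also have "\<dots> = apply_bcontfun y (m + j) * contour_integral (circlepath 0 r) (\<lambda>l. f l * l powi (- int j - 1))"
      using r
      by (intro contour_integral_lmul contour_integrable_continuous_circlepath continuous_intros)
        (auto intro!: cont)
    finally show ?thesis
      unfolding laurent_coeff_eq[OF hol \<rho>(1) \<open>1 / \<rho> < r\<close> r(2)] by simp
  qed
  ultimately show ?thesis
    by (simp add: \<phi>_def)
qed

section \<open>Toeplitz operators\<close>

text \<open>The matrix with entry \<open>c (i - m)\<close> in row \<open>m\<close> and column
  \<open>i\<close>. The difference is formed in the integers, so negative indices give the entries
  below the diagonal.\<close>

definition toeplitz :: "(int \<Rightarrow> complex) \<Rightarrow> linf \<Rightarrow> linf"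
  where "toeplitz c x = Bcontfun (\<lambda>m. \<Sum>\<^sub>\<infinity>i. c (int i - int m) * apply_bcontfun x i)"

text \<open>A row is an injective reindexing of a part of the family \<open>c\<close>, so the sum of
  all |c k| bounds every row uniformly.\<close>

lemma toeplitz_row:
  fixes c :: "int \<Rightarrow> complex" and x :: linf
  assumes c: "c summable_on UNIV"
  shows "(\<lambda>i. c (int i - int m) * apply_bcontfun x i) summable_on UNIV" (is ?s)
    and "(\<lambda>i. norm (c (int i - k) * apply_bcontfun x i)) summable_on UNIV" (is ?a)
    and "(\<Sum>\<^sub>\<infinity>i. norm (c (int i - k) * apply_bcontfun x i)) \<le> (\<Sum>\<^sub>\<infinity>k. norm (c k)) * norm x" (is ?b)
proof -
  have abs: "(\<lambda>k. norm (c k)) summable_on UNIV"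
    by (rule summable_on_iff_abs_summable_on_complex[THEN iffD1, OF c])
  have inj: "inj (\<lambda>i::nat. int i - k)" for k
    by (auto simp: inj_def)
  have row: "(\<lambda>i. norm (c (int i - k))) summable_on UNIV" for k
    using summable_on_reindex[OF inj, of "\<lambda>k. norm (c k)" k] summable_on_subset_banach[OF abs subset_UNIV]
    by (simp add: o_def)
  have row_le: "(\<Sum>\<^sub>\<infinity>i. norm (c (int i - k))) \<le> (\<Sum>\<^sub>\<infinity>k. norm (c k))"
  proof -
    have "(\<Sum>\<^sub>\<infinity>i. norm (c (int i - k))) = (\<Sum>\<^sub>\<infinity>l\<in>range (\<lambda>i. int i - k). norm (c l))"
      using infsum_reindex[OF inj, of "\<lambda>k. norm (c k)" k] by (simp add: o_def)
    also have "\<dots> \<le> (\<Sum>\<^sub>\<infinity>k. norm (c k))"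
      using abs by (intro infsum_mono2 summable_on_subset_banach[OF abs]) auto
    finally show ?thesis .
  qed
  have le: "norm (c (int i - k) * apply_bcontfun x i) \<le> norm (c (int i - k)) * norm x" for i k
    by (auto simp: norm_mult intro!: mult_left_mono norm_bounded)
  have all: "(\<lambda>i. norm (c (int i - k) * apply_bcontfun x i)) summable_on UNIV" for k
    using summable_on_cmult_left[OF row] le by (rule Infinite_Sum.abs_summable_on_comparison_test')
  show ?a
    by (rule all)
  show ?s
    using Infinite_Sum.abs_summable_summable[OF all] .
  have "(\<Sum>\<^sub>\<infinity>i. norm (c (int i - k) * apply_bcontfun x i)) \<le> (\<Sum>\<^sub>\<infinity>i. norm (c (int i - k)) * norm x)"
    by (intro infsum_mono all summable_on_cmult_left row le)
  also have "\<dots> = (\<Sum>\<^sub>\<infinity>i. norm (c (int i - k))) * norm x"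
    by (rule infsum_cmult_left) (rule row)
  also have "\<dots> \<le> (\<Sum>\<^sub>\<infinity>k. norm (c k)) * norm x"
    by (intro mult_right_mono row_le) simp
  finally show ?b .
qed

lemma norm_toeplitz_row_le:
  fixes c :: "int \<Rightarrow> complex" and x :: linf
  assumes "c summable_on UNIV"
  shows "norm (\<Sum>\<^sub>\<infinity>i. c (int i - int m) * apply_bcontfun x i) \<le> (\<Sum>\<^sub>\<infinity>k. norm (c k)) * norm x"
  using norm_infsum_bound[OF toeplitz_row(2)[OF assms]] toeplitz_row(3)[OF assms] by (rule order_trans)

lemma toeplitz_apply:
  assumes "c summable_on UNIV"
  shows "apply_bcontfun (toeplitz c x) m = (\<Sum>\<^sub>\<infinity>i. c (int i - int m) * apply_bcontfun x i)"
  unfolding toeplitz_def using apply_Bcontfun_nat[OF norm_toeplitz_row_le[OF assms]] by (rule fun_cong)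

lemma norm_toeplitz_le:
  assumes "c summable_on UNIV"
  shows "norm (toeplitz c x) \<le> (\<Sum>\<^sub>\<infinity>k. norm (c k)) * norm x"
  by (rule norm_bound) (simp only: toeplitz_apply[OF assms] norm_toeplitz_row_le[OF assms])

text \<open>Row \<open>m\<close> starts at the diagonal; the reindexing i = m + j turns the
  unordered sum into a series of the same form as the formula for f(B).\<close>

lemma toeplitz_upper_triangular_sums:
  assumes a: "a summable_on UNIV" "\<And>k. k < 0 \<Longrightarrow> a k = 0"
  shows "(\<lambda>j. a (int j) * apply_bcontfun x (m + j)) sums apply_bcontfun (toeplitz a x) m"
proof -
  have "((\<lambda>i. a (int i - int m) * apply_bcontfun x i) has_sum apply_bcontfun (toeplitz a x) m) UNIV"
    unfolding toeplitz_apply[OF a(1)] using toeplitz_row(1)[OF a(1)] by (rule has_sum_infsum)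
  then have "((\<lambda>i. a (int i - int m) * apply_bcontfun x i) has_sum apply_bcontfun (toeplitz a x) m) (range (\<lambda>j. m + j))"
    by (rule has_sum_cong_neutral[THEN iffD1, rotated -1])
      (use a(2) in \<open>auto simp: nat_le_iff_add[symmetric] image_iff\<close>)
  then have "((\<lambda>j. a (int j) * apply_bcontfun x (m + j)) has_sum apply_bcontfun (toeplitz a x) m) UNIV"
    by (subst (asm) has_sum_reindex) (auto simp: o_def)
  then show ?thesis
    by (rule has_sum_imp_sums)
qed

text \<open>Since the left factor is upper triangular, the intermediate index m + j runs over all j
  \<ge> 0 without being cut off at 0. The matrix product is therefore the full convolution and again
  a Toeplitz matrix.\<close>

lemma toeplitz_toeplitz:
  assumes a: "a summable_on UNIV" "\<And>k. k < 0 \<Longrightarrow> a k = 0"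
    and c: "c summable_on UNIV" and d: "d summable_on UNIV"
    and conv: "\<And>k. (\<lambda>j. a (int j) * c (k - int j)) sums d k"
  shows "toeplitz a (toeplitz c x) = toeplitz d x"
proof (rule bcontfun_eqI)
  fix m
  define F where "F j i = a (int j) * (c (int i - int (m + j)) * apply_bcontfun x i)" for j i
  define C where "C = (\<Sum>\<^sub>\<infinity>k. norm (c k))"
  have a_nat: "(\<lambda>j. norm (a (int j))) summable_on UNIV"
    using a(1) summable_on_iff_abs_summable_on_complex[of a UNIV] summable_on_reindex[of int UNIV "\<lambda>k. norm (a k)"]
      summable_on_subset_banach[of "\<lambda>k. norm (a k)" UNIV "range int"]
    by (simp add: o_def)
  have row: "(\<lambda>i. norm (F j i)) summable_on UNIV" for j
    unfolding F_def norm_mult[of "a _"] by (intro summable_on_cmult_right toeplitz_row(2)[OF c])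
  have row_le: "(\<Sum>\<^sub>\<infinity>i. norm (F j i)) \<le> norm (a (int j)) * (C * norm x)" for j
    unfolding F_def norm_mult[of "a _"] infsum_cmult_right' C_def
    by (intro mult_left_mono toeplitz_row(3)[OF c]) simp
  \<comment> \<open>The absolute row sums are at most |a j| \<open>C\<close> |x|, which is summable
    over \<open>j\<close>; so the two sums may be interchanged.\<close>
  have "(\<lambda>x. norm (case x of (j, i) \<Rightarrow> F j i)) summable_on UNIV \<times> UNIV"
    unfolding Infinite_Sum.abs_summable_on_Sigma_iff
  proof (intro conjI ballI)
    show "(\<lambda>j. norm (\<Sum>\<^sub>\<infinity>i. norm (case (j, i) of (j, i) \<Rightarrow> F j i))) summable_on UNIV"
      using summable_on_cmult_left[OF a_nat, of "C * norm x"] row_le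
      by (intro Infinite_Sum.abs_summable_on_comparison_test') (auto simp: infsum_nonneg)
  qed (use row in simp)
  then have "(\<lambda>(j, i). F j i) summable_on UNIV \<times> UNIV"
    by (rule Infinite_Sum.abs_summable_summable)
  then have swap: "(\<Sum>\<^sub>\<infinity>j. \<Sum>\<^sub>\<infinity>i. F j i) = (\<Sum>\<^sub>\<infinity>i. \<Sum>\<^sub>\<infinity>j. F j i)"
    and sum_rows: "(\<lambda>j. \<Sum>\<^sub>\<infinity>i. F j i) summable_on UNIV"
    using infsum_swap_banach[of F UNIV UNIV] summable_on_Sigma_banach[of F UNIV "\<lambda>_. UNIV"] by auto
  have "(\<lambda>j. \<Sum>\<^sub>\<infinity>i. F j i) sums apply_bcontfun (toeplitz a (toeplitz c x)) m"
    using toeplitz_upper_triangular_sums[OF a, of "toeplitz c x" m]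
    by (simp only: F_def toeplitz_apply[OF c] infsum_cmult_right')
  moreover have "(\<lambda>j. \<Sum>\<^sub>\<infinity>i. F j i) sums (\<Sum>\<^sub>\<infinity>j. \<Sum>\<^sub>\<infinity>i. F j i)"
    using sum_rows by (intro has_sum_imp_sums has_sum_infsum)
  ultimately have "apply_bcontfun (toeplitz a (toeplitz c x)) m = (\<Sum>\<^sub>\<infinity>i. \<Sum>\<^sub>\<infinity>j. F j i)"
    unfolding swap[symmetric] by (rule sums_unique2)
  also have "\<dots> = (\<Sum>\<^sub>\<infinity>i. d (int i - int m) * apply_bcontfun x i)"
  proof (rule infsum_cong)
    fix i
    have c_le: "norm (c k) \<le> C" for k
    proof -
      have "norm (c k) = (\<Sum>\<^sub>\<infinity>k\<in>{k}. norm (c k))"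
        by simp
      also have "\<dots> \<le> C"
        unfolding C_def using c summable_on_iff_abs_summable_on_complex[of c UNIV] by (intro infsum_mono2) auto
      finally show ?thesis .
    qed
    have "0 \<le> C"
      unfolding C_def by (intro infsum_nonneg) simp
    then have "norm (F j i) \<le> norm (a (int j)) * (C * norm x)" for j
      unfolding F_def norm_mult by (intro mult_left_mono mult_mono c_le norm_bounded) auto
    then have "(\<lambda>j. norm (F j i)) summable_on UNIV"
      by (rule Infinite_Sum.abs_summable_on_comparison_test'[OF summable_on_cmult_left[OF a_nat]])
    then have "(\<lambda>j. F j i) sums (\<Sum>\<^sub>\<infinity>j. F j i)"
      by (rule has_sum_imp_sums[OF has_sum_infsum[OF Infinite_Sum.abs_summable_summable]])
    moreover have "(\<lambda>j. F j i) sums (d (int i - int m) * apply_bcontfun x i)"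
      using sums_mult2[OF conv[of "int i - int m"], of "apply_bcontfun x i"]
      by (simp add: F_def mult.assoc diff_diff_eq)
    ultimately show "(\<Sum>\<^sub>\<infinity>j. F j i) = d (int i - int m) * apply_bcontfun x i"
      by (rule sums_unique2)
  qed
  also have "\<dots> = apply_bcontfun (toeplitz d x) m"
    by (simp add: toeplitz_apply[OF d])
  finally show "apply_bcontfun (toeplitz a (toeplitz c x)) m = apply_bcontfun (toeplitz d x) m" .
qed

lemma summable_on_geometric_int:
  fixes t :: real
  assumes "0 \<le> t" "t < 1"
  shows "(\<lambda>k::int. t ^ nat \<bar>k\<bar>) summable_on UNIV"
proof -
  have t: "(\<lambda>n. t ^ n) summable_on (UNIV :: nat set)" "(\<lambda>n. t ^ Suc n) summable_on (UNIV :: nat set)"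
    using assms by (auto simp: summable_on_UNIV_nonneg_real_iff summable_Suc_iff simp del: power_Suc)
  have "(\<lambda>k::int. t ^ nat \<bar>k\<bar>) summable_on {0..}"
    using t(1) by (subst summable_on_reindex_bij_witness[of _ int nat UNIV "\<lambda>n. t ^ n"]) auto
  moreover have "(\<lambda>k::int. t ^ nat \<bar>k\<bar>) summable_on {..<0}"
    using t(2)
    by (subst summable_on_reindex_bij_witness[of _ "\<lambda>n. - int n - 1" "\<lambda>k. nat (- k - 1)" UNIV "\<lambda>n. t ^ Suc n"])
      (auto simp flip: power_Suc intro!: arg_cong[where f = "\<lambda>n. t ^ n"])
  moreover have "(UNIV :: int set) = {0..} \<union> {..<0}" "{0..} \<inter> {..<0::int} = {}"
    by auto
  ultimately show ?thesis
    using summable_on_Un_disjoint[of "\<lambda>k::int. t ^ nat \<bar>k\<bar>" "{0..}" "{..<0}"] by auto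
qed

text \<open>The constant does not depend on \<open>g\<close>, so it serves all the symbols f^(-n) at
  once. It is the two-sided geometric sum with ratio 1/q for some \<open>q\<close> between 1 and
  \<rho>.\<close>

lemma laurent_coeff_abs_summable:
  assumes \<rho>: "1 < \<rho>"
  shows "\<exists>K\<ge>0. \<forall>g M. g holomorphic_on annulus \<rho> \<longrightarrow> (\<forall>z\<in>annulus \<rho>. norm (g z) \<le> M) \<longrightarrow>
    laurent_coeff g summable_on UNIV \<and> (\<Sum>\<^sub>\<infinity>k. norm (laurent_coeff g k)) \<le> M * K"
proof -
  obtain q where q: "1 < q" "q < \<rho>"
    using \<rho> dense by blast
  have geo: "(\<lambda>k::int. (1 / q) ^ nat \<bar>k\<bar>) summable_on UNIV"
    using q by (intro summable_on_geometric_int) auto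
  show ?thesis
  proof (intro exI[of _ "\<Sum>\<^sub>\<infinity>k::int. (1 / q) ^ nat \<bar>k\<bar>"] conjI[of "0 \<le> _"] allI impI)
    show "0 \<le> (\<Sum>\<^sub>\<infinity>k::int. (1 / q) ^ nat \<bar>k\<bar>)"
      using q by (intro infsum_nonneg) auto
    fix g M assume g: "g holomorphic_on annulus \<rho>" and M: "\<forall>z\<in>annulus \<rho>. norm (g z) \<le> M"
    have le: "norm (laurent_coeff g k) \<le> M * (1 / q) ^ nat \<bar>k\<bar>" for k
      by (rule norm_laurent_coeff_le[OF g bspec[OF M] q])
    have geoM: "(\<lambda>k::int. M * (1 / q) ^ nat \<bar>k\<bar>) summable_on UNIV"
      by (intro summable_on_cmult_right geo)
    then have abs: "(\<lambda>k. norm (laurent_coeff g k)) summable_on UNIV"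
      using le by (rule Infinite_Sum.abs_summable_on_comparison_test')
    have "(\<Sum>\<^sub>\<infinity>k. norm (laurent_coeff g k)) \<le> (\<Sum>\<^sub>\<infinity>k::int. M * (1 / q) ^ nat \<bar>k\<bar>)"
      by (intro infsum_mono abs geoM le)
    then show "laurent_coeff g summable_on UNIV \<and>
        (\<Sum>\<^sub>\<infinity>k. norm (laurent_coeff g k)) \<le> M * (\<Sum>\<^sub>\<infinity>k::int. (1 / q) ^ nat \<bar>k\<bar>)"
      using Infinite_Sum.abs_summable_summable[OF abs] by (simp add: infsum_cmult_right')
  qed
qed

section \<open>Dynamics of \<open>f(B)\<close>\<close>

lemma annulus_subset_ball: "annulus \<rho> \<subseteq> ball 0 \<rho>"
  by (auto simp: annulus_def)

lemma annulusI: "1 < \<rho> \<Longrightarrow> 1 \<le> norm z \<Longrightarrow> norm z < \<rho> \<Longrightarrow> z \<in> annulus \<rho>"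
  using less_le_trans[of "1 / \<rho>" 1 "norm z"] by (simp add: annulus_def)

lemma annulus_mono: "0 < \<rho> \<Longrightarrow> \<rho> \<le> \<rho>' \<Longrightarrow> annulus \<rho> \<subseteq> annulus \<rho>'"
  using frac_le[of 1 1 \<rho> \<rho>'] by (auto simp: annulus_def)

lemma obtain_annulus:
  assumes "open V" "sphere 0 1 \<subseteq> V"
  obtains \<rho> where "1 < \<rho>" "annulus \<rho> \<subseteq> V"
proof -
  obtain e where e: "0 < e" "(\<Union>x\<in>sphere 0 1. ball x e) \<subseteq> V"
    using compact_subset_open_imp_ball_epsilon_subset[OF compact_sphere assms] .
  have "z \<in> V" if z: "z \<in> annulus (1 + e)" for z
  proof -
    \<comment> \<open>The inner radius 1/(1 + e) exceeds 1 - e, so \<open>z\<close> lies within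
      \<open>e\<close> of its radial projection to the circle.\<close>
    have "1 - e < 1 / (1 + e)"
      using e(1) by (simp add: field_simps)
    then have "\<bar>norm z - 1\<bar> < e"
      using z by (auto simp: annulus_def)
    moreover have "z \<noteq> 0"
      using z e(1) by (auto simp: annulus_def)
    then have "dist (z /\<^sub>R norm z) z = \<bar>norm z - 1\<bar>"
    proof -
      have "z /\<^sub>R norm z - z = (inverse (norm z) - 1) *\<^sub>R z"
        by (simp add: algebra_simps)
      then have "dist (z /\<^sub>R norm z) z = \<bar>inverse (norm z) - 1\<bar> * \<bar>norm z\<bar>"
        by (simp add: dist_norm)
      also have "\<dots> = \<bar>1 - norm z\<bar>"
        unfolding abs_mult[symmetric] using \<open>z \<noteq> 0\<close> by (simp add: left_diff_distrib)
      also have "\<dots> = \<bar>norm z - 1\<bar>"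
        by (rule abs_minus_commute)
      finally show ?thesis .
    qed
    moreover have "z /\<^sub>R norm z \<in> sphere 0 1"
      using \<open>z \<noteq> 0\<close> by simp
    ultimately show ?thesis
      using e(2) by (metis UN_I mem_ball subsetD)
  qed
  then show thesis
    using that[of "1 + e"] e(1) by auto
qed

lemma obtain_disc:
  assumes "open U" "cball 0 1 \<subseteq> U"
  obtains \<rho> where "1 < \<rho>" "cball (0 :: complex) \<rho> \<subseteq> U"
proof -
  obtain \<rho> where \<rho>: "1 < \<rho>" "annulus \<rho> \<subseteq> U"
    using obtain_annulus[OF assms(1)] assms(2) by (metis order_trans sphere_cball)
  obtain r where r: "1 < r" "r < \<rho>"
    using \<rho>(1) dense by blast
  have "z \<in> U" if "norm z \<le> r" for z
  proof (cases "norm z \<le> 1")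
    case False
    then have "z \<in> annulus \<rho>"
      using that r \<rho>(1) by (intro annulusI) auto
    then show ?thesis
      using \<rho>(2) by blast
  qed (use assms(2) in auto)
  then have "cball 0 r \<subseteq> U"
    by auto
  then show thesis
    by (rule that[OF r(1)])
qed

section \<open>Multiplication of symbols\<close>

lemma laurent_coeff_summable:
  assumes "1 < \<rho>" "g holomorphic_on annulus \<rho>" "\<And>z. z \<in> annulus \<rho> \<Longrightarrow> norm (g z) \<le> M"
  shows "laurent_coeff g summable_on UNIV"
  using laurent_coeff_abs_summable[OF assms(1)] assms(2,3) by blast

lemma toeplitz_laurent_one: "toeplitz (laurent_coeff (\<lambda>_. 1)) x = x"
proof (rule bcontfun_eqI)
  fix m
  have "laurent_coeff (\<lambda>_. 1) summable_on UNIV"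
    by (rule laurent_coeff_summable[of 2 _ 1]) auto
  then have "(\<lambda>j. laurent_coeff (\<lambda>_. 1) (int j) * apply_bcontfun x (m + j)) sums
      apply_bcontfun (toeplitz (laurent_coeff (\<lambda>_. 1)) x) m"
    by (rule toeplitz_upper_triangular_sums) (simp add: laurent_coeff_holomorphic(2)[of _ 2])
  moreover have "(\<lambda>j. laurent_coeff (\<lambda>_. 1) (int j) * apply_bcontfun x (m + j)) =
      (\<lambda>j. if j = 0 then apply_bcontfun x m else 0)"
    by (auto simp: laurent_coeff_holomorphic(1)[of _ 2] higher_deriv_const)
  ultimately show "apply_bcontfun (toeplitz (laurent_coeff (\<lambda>_. 1)) x) m = apply_bcontfun x m"
    using sums_single[of 0 "\<lambda>_. apply_bcontfun x m"] sums_unique2 by metis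
qed

text \<open>Only the left symbol extends to the disc. This asymmetry is why f^(-n) always yields a
  right inverse of f(B)^n, but a left inverse if \<open>f\<close> has no zeros.\<close>

lemma toeplitz_laurent_mult:
  assumes \<rho>: "1 < \<rho>" and h: "h holomorphic_on ball 0 \<rho>" "\<And>z. z \<in> annulus \<rho> \<Longrightarrow> norm (h z) \<le> M"
    and g: "g holomorphic_on annulus \<rho>" "\<And>z. z \<in> annulus \<rho> \<Longrightarrow> norm (g z) \<le> N"
  shows "toeplitz (laurent_coeff h) (toeplitz (laurent_coeff g) x) = toeplitz (laurent_coeff (\<lambda>z. h z * g z)) x"
proof -
  have h': "h holomorphic_on annulus \<rho>"
    using h(1) annulus_subset_ball holomorphic_on_subset by blast
  have "norm (h z * g z) \<le> M * N" if "z \<in> annulus \<rho>" for z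
    unfolding norm_mult using h(2) g(2) that order_trans[OF norm_ge_zero h(2)] by (intro mult_mono) auto
  then have "laurent_coeff (\<lambda>z. h z * g z) summable_on UNIV"
    by (intro laurent_coeff_summable[OF \<rho>] holomorphic_intros h' g(1))
  then show ?thesis
    using laurent_coeff_summable[OF \<rho> h' h(2)] laurent_coeff_summable[OF \<rho> g] laurent_coeff_holomorphic(2)[OF h(1) \<rho>] laurent_coeff_mult_sums[OF h(1) g(1) \<rho>]
    by (intro toeplitz_toeplitz) auto
qed

section \<open>The operator f(B) as a Toeplitz operator\<close>

locale backward_shift_calculus =
  fixes f :: "complex \<Rightarrow> complex" and U :: "complex set" and \<rho> M :: real
  assumes U: "open U" "f holomorphic_on U" and \<rho>: "1 < \<rho>" "ball 0 \<rho> \<subseteq> U"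
    and M: "\<And>z. z \<in> ball 0 \<rho> \<Longrightarrow> norm (f z) \<le> M"
begin

definition T :: "linf \<Rightarrow>\<^sub>L linf"
  where "T = holomorphic_calculus U f backward_shift"

lemma holomorphic: "f holomorphic_on ball 0 \<rho>" "f holomorphic_on annulus \<rho>"
  using U(2) \<rho>(2) annulus_subset_ball holomorphic_on_subset by blast+

lemma bounded_annulus: "z \<in> annulus \<rho> \<Longrightarrow> norm (f z) \<le> M"
  using M annulus_subset_ball by blast

lemma T_sums: "(\<lambda>j. laurent_coeff f (int j) * apply_bcontfun y (m + j)) sums apply_bcontfun (T y) m"
  unfolding T_def by (rule holomorphic_calculus_backward_shift_sums[OF U \<rho>])

lemma power_series: "norm z < \<rho> \<Longrightarrow> (\<lambda>j. laurent_coeff f (int j) * z ^ j) sums f z"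
  using holomorphic_power_series[OF holomorphic(1), of z]
  by (simp add: laurent_coeff_holomorphic(1)[OF holomorphic(1) \<rho>(1)])

lemma T_eq_toeplitz: "T y = toeplitz (laurent_coeff f) y"
proof (rule bcontfun_eqI)
  fix m
  have "laurent_coeff f summable_on UNIV"
    by (rule laurent_coeff_summable[OF \<rho>(1) holomorphic(2) bounded_annulus])
  then have "(\<lambda>j. laurent_coeff f (int j) * apply_bcontfun y (m + j)) sums
      apply_bcontfun (toeplitz (laurent_coeff f) y) m"
    by (rule toeplitz_upper_triangular_sums) (rule laurent_coeff_holomorphic(2)[OF holomorphic(1) \<rho>(1)])
  then show "apply_bcontfun (T y) m = apply_bcontfun (toeplitz (laurent_coeff f) y) m"
    using T_sums sums_unique2 by blast
qed

lemma T_geometric_seq: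
  assumes "norm z \<le> 1"
  shows "T (geometric_seq z) = f z *\<^sub>C geometric_seq z"
proof (rule bcontfun_eqI)
  fix m
  have "(\<lambda>j. laurent_coeff f (int j) * z ^ j * z ^ m) sums (f z * z ^ m)"
    using power_series[of z] assms \<rho>(1) by (intro sums_mult2) simp
  then have "(\<lambda>j. laurent_coeff f (int j) * apply_bcontfun (geometric_seq z) (m + j)) sums (f z * z ^ m)"
    by (simp add: geometric_seq_apply[OF assms] power_add mult_ac)
  then have "apply_bcontfun (T (geometric_seq z)) m = f z * z ^ m"
    by (rule sums_unique2[OF T_sums])
  then show "apply_bcontfun (T (geometric_seq z)) m = apply_bcontfun (f z *\<^sub>C geometric_seq z) m"
    by (simp add: geometric_seq_apply[OF assms] scaleC_complex_def)
qed

lemma funpow_T_add: "(blinfun_apply T ^^ k) (x + y) = (blinfun_apply T ^^ k) x + (blinfun_apply T ^^ k) y"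
  by (induction k) (simp_all add: blinfun.add_right)

lemma funpow_T_zero: "(blinfun_apply T ^^ k) 0 = 0"
  by (induction k) (simp_all add: blinfun.zero_right)

text \<open>Not the iterates of \<open>S 1\<close>: Toeplitz operators need not multiply like their
  symbols. The direct definition lets the decay of f^(-n) bound the norm.\<close>

definition S :: "nat \<Rightarrow> linf \<Rightarrow> linf"
  where "S n = toeplitz (laurent_coeff (\<lambda>z. inverse (f z) ^ n))"

section \<open>Symbols of modulus at least \<kappa> > 1 on an annulus\<close>

context
  fixes \<kappa> :: real
  assumes \<kappa>: "1 < \<kappa>" "\<And>z. z \<in> annulus \<rho> \<Longrightarrow> \<kappa> \<le> norm (f z)"
begin

lemma f_nonzero: "z \<in> annulus \<rho> \<Longrightarrow> f z \<noteq> 0"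
  using \<kappa> by fastforce

lemma holomorphic_inverse_power: "(\<lambda>z. inverse (f z) ^ n) holomorphic_on annulus \<rho>"
  by (intro holomorphic_intros holomorphic f_nonzero)

lemma norm_inverse_power_le:
  assumes "z \<in> annulus \<rho>"
  shows "norm (inverse (f z) ^ n) \<le> (1 / \<kappa>) ^ n"
proof -
  have "inverse (norm (f z)) \<le> inverse \<kappa>"
    using \<kappa>(1) \<kappa>(2)[OF assms] by (intro le_imp_inverse_le) auto
  then show ?thesis
    by (auto simp: norm_power norm_inverse inverse_eq_divide norm_divide intro!: power_mono)
qed

lemma norm_S_le:
  obtains K where "0 \<le> K" "\<And>n x. norm (S n x) \<le> K * (1 / \<kappa>) ^ n * norm x"
proof -
  obtain K where K: "0 \<le> K" "\<And>g M. g holomorphic_on annulus \<rho> \<Longrightarrow> \<forall>z\<in>annulus \<rho>. norm (g z) \<le> M \<Longrightarrow>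
      laurent_coeff g summable_on UNIV \<and> (\<Sum>\<^sub>\<infinity>k. norm (laurent_coeff g k)) \<le> M * K"
    using laurent_coeff_abs_summable[OF \<rho>(1)] by blast
  have "norm (S n x) \<le> K * (1 / \<kappa>) ^ n * norm x" for n x
  proof -
    have *: "laurent_coeff (\<lambda>z. inverse (f z) ^ n) summable_on UNIV"
        "(\<Sum>\<^sub>\<infinity>k. norm (laurent_coeff (\<lambda>z. inverse (f z) ^ n) k)) \<le> (1 / \<kappa>) ^ n * K"
      using K(2)[OF holomorphic_inverse_power[of n], of "(1 / \<kappa>) ^ n"] norm_inverse_power_le by blast+
    have "norm (S n x) \<le> (\<Sum>\<^sub>\<infinity>k. norm (laurent_coeff (\<lambda>z. inverse (f z) ^ n) k)) * norm x"
      unfolding S_def by (rule norm_toeplitz_le[OF *(1)])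
    also have "\<dots> \<le> (1 / \<kappa>) ^ n * K * norm x"
      using *(2) by (intro mult_right_mono) auto
    finally show ?thesis
      by (simp add: mult_ac)
  qed
  with K(1) show thesis
    by (rule that)
qed

lemma S_0: "S 0 x = x"
  by (simp add: S_def toeplitz_laurent_one)

lemma T_S: "T (S (Suc n) x) = S n x"
proof -
  have "T (S (Suc n) x) = toeplitz (laurent_coeff (\<lambda>z. f z * inverse (f z) ^ Suc n)) x"
    unfolding T_eq_toeplitz S_def
    by (rule toeplitz_laurent_mult[OF \<rho>(1) holomorphic(1) bounded_annulus holomorphic_inverse_power norm_inverse_power_le])
  \<comment> \<open>Laurent coefficients see the symbol on the unit circle only, where
    \<open>f\<close> has no zero and one factor cancels.\<close>
  also have "laurent_coeff (\<lambda>z. f z * inverse (f z) ^ Suc n) = laurent_coeff (\<lambda>z. inverse (f z) ^ n)"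
    by (rule laurent_coeff_cong) (use f_nonzero sphere_subset_annulus[OF \<rho>(1)] in auto)
  finally show ?thesis
    by (simp add: S_def)
qed

lemma funpow_T_S: "(blinfun_apply T ^^ n) (S n x) = x"
  by (induction n) (simp_all add: S_0 T_S funpow_swap1)

text \<open>Without zeros in the disc the symbol f^(-n) is holomorphic there and may stand on the
  left.\<close>

lemma S_funpow_T:
  assumes "\<And>z. z \<in> ball 0 \<rho> \<Longrightarrow> f z \<noteq> 0"
  shows "S n ((blinfun_apply T ^^ n) x) = x"
proof (induction n arbitrary: x)
  case (Suc n)
  have "S (Suc n) (T y) = S n y" for y
  proof -
    have "(\<lambda>z. inverse (f z) ^ Suc n) holomorphic_on ball 0 \<rho>"
      by (intro holomorphic_intros holomorphic assms)
    then have "S (Suc n) (T y) = toeplitz (laurent_coeff (\<lambda>z. inverse (f z) ^ Suc n * f z)) y"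
      unfolding T_eq_toeplitz S_def
      by (rule toeplitz_laurent_mult[OF \<rho>(1) _ norm_inverse_power_le holomorphic(2) bounded_annulus])
    also have "laurent_coeff (\<lambda>z. inverse (f z) ^ Suc n * f z) = laurent_coeff (\<lambda>z. inverse (f z) ^ n)"
      by (rule laurent_coeff_cong) (use f_nonzero sphere_subset_annulus[OF \<rho>(1)] in auto)
    finally show ?thesis
      by (simp add: S_def)
  qed
  then show ?case
    using Suc by simp
qed (simp add: S_0)

text \<open>If \<open>f z = 0\<close>, then \<open>e = (z\<^sup>m)\<^sub>m\<close> lies in the kernel of \<open>f(B)\<close>, and \<open>e + S n y\<close> converges to \<open>e\<close>
  and is mapped to \<open>y\<close> by the \<open>n\<close>-th power of \<open>f(B)\<close>.\<close>

lemma J_class_if_zero: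
  assumes z: "norm z < 1" "f z = 0"
  shows "J_class T"
proof -
  define e where "e = geometric_seq z"
  have "e \<noteq> 0"
    using geometric_seq_apply[of z 0] z(1) by (auto simp: e_def)
  have "T e = 0"
    using T_geometric_seq[of z] z by (simp add: e_def)
  obtain K where K: "\<And>n x. norm (S n x) \<le> K * (1 / \<kappa>) ^ n * norm x"
    using norm_S_le by metis
  have "y \<in> J_set T e" for y
  proof -
    have "(\<lambda>n. K * (1 / \<kappa>) ^ n * norm y) \<longlonglongrightarrow> K * 0 * norm y"
      using \<kappa>(1) by (intro tendsto_intros LIMSEQ_power_zero) auto
    then have "(\<lambda>n. S n y) \<longlonglongrightarrow> 0"
      using K by (intro Lim_null_comparison[of "\<lambda>n. S n y"]) auto
    \<comment> \<open>The index is \<open>Suc n\<close> because f(B) annihilates \<open>e\<close>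
      only from the first power on.\<close>
    then have "(\<lambda>n. e + S (Suc n) y) \<longlonglongrightarrow> e + 0"
      by (intro tendsto_add tendsto_const LIMSEQ_Suc)
    moreover have "(blinfun_apply T ^^ Suc n) (e + S (Suc n) y) = y" for n
      using funpow_T_S[of "Suc n" y] \<open>T e = 0\<close> funpow_T_zero[of n]
      by (simp only: funpow_T_add) (simp add: funpow_swap1)
    ultimately show ?thesis
      unfolding J_set_def
      by (auto intro!: exI[of _ Suc] exI[of _ "\<lambda>n. e + S (Suc n) y"] simp: strict_mono_def simp del: funpow.simps)
  qed
  then show ?thesis
    using \<open>e \<noteq> 0\<close> by (auto simp: J_class_def)
qed

text \<open>Without a zero, applying \<open>S (k n)\<close> recovers \<open>xs n\<close> from its
  image, so the norm of \<open>xs n\<close> is at most \<open>K\<close> times that of the image.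
  Images tending to 0 then force the limit \<open>x\<close> to be 0.\<close>

lemma zero_if_J_class:
  assumes "J_class T"
  obtains z where "norm z < 1" "f z = 0"
proof (rule ccontr)
  assume "\<not> thesis"
  then have nz: "f z \<noteq> 0" if "norm z < 1" for z
    using that \<open>\<And>z. norm z < 1 \<Longrightarrow> f z = 0 \<Longrightarrow> thesis\<close> by blast
  \<comment> \<open>Points of the larger disc outside the open unit disc lie in the annulus, where
    |f| \<ge> \<kappa>.\<close>
  have nonzero: "f z \<noteq> 0" if "z \<in> ball 0 \<rho>" for z
  proof (cases "norm z < 1")
    case False
    then show ?thesis
      using that \<rho>(1) by (intro f_nonzero annulusI) auto
  qed (rule nz)
  obtain x where x: "x \<noteq> 0" "0 \<in> J_set T x"
    using assms by (auto simp: J_class_def)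
  then obtain k xs where xs: "xs \<longlonglongrightarrow> x" and lim: "(\<lambda>n. (blinfun_apply T ^^ k n) (xs n)) \<longlonglongrightarrow> 0"
    by (auto simp: J_set_def)
  obtain K where K: "0 \<le> K" "\<And>n x. norm (S n x) \<le> K * (1 / \<kappa>) ^ n * norm x"
    using norm_S_le by metis
  have "norm (xs n) \<le> K * norm ((blinfun_apply T ^^ k n) (xs n))" for n
  proof -
    have "K * (1 / \<kappa>) ^ k n \<le> K * 1"
      using K(1) \<kappa>(1) by (intro mult_left_mono power_le_one) auto
    then have "K * (1 / \<kappa>) ^ k n * norm ((blinfun_apply T ^^ k n) (xs n)) \<le> K * 1 * norm ((blinfun_apply T ^^ k n) (xs n))"
      by (intro mult_right_mono) auto
    then show ?thesis
      using K(2)[of "k n" "(blinfun_apply T ^^ k n) (xs n)"] S_funpow_T[OF nonzero] by simp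
  qed
  moreover have "(\<lambda>n. K * norm ((blinfun_apply T ^^ k n) (xs n))) \<longlonglongrightarrow> 0"
    using tendsto_mult_right_zero[OF tendsto_norm_zero[OF lim]] by blast
  ultimately have "xs \<longlonglongrightarrow> 0"
    by (intro Lim_null_comparison[of xs]) auto
  then show False
    using xs x(1) LIMSEQ_unique by blast
qed

end

end

section \<open>Weighted Cesaro means\<close>

definition cesaro_mean :: "complex \<Rightarrow> nat \<Rightarrow> linf \<Rightarrow> complex"
  where "cesaro_mean l N x = (\<Sum>m<N. inverse l ^ m * apply_bcontfun x m) / of_nat N"

lemma cesaro_mean_diff: "cesaro_mean l N (x - y) = cesaro_mean l N x - cesaro_mean l N y"
  by (simp add: cesaro_mean_def right_diff_distrib sum_subtractf diff_divide_distrib)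

lemma norm_cesaro_mean_le:
  assumes "norm l = 1"
  shows "norm (cesaro_mean l N x) \<le> norm x"
proof (cases "N = 0")
  case False
  have "norm (\<Sum>m<N. inverse l ^ m * apply_bcontfun x m) \<le> (\<Sum>m<N. norm x)"
    using assms by (intro sum_norm_le) (simp add: norm_mult norm_power norm_inverse norm_bounded)
  then show ?thesis
    using False by (simp add: cesaro_mean_def norm_divide field_simps)
qed (simp add: cesaro_mean_def)

text \<open>A shift by one place changes the weighted sum, up to the factor \<open>l\<close>, only
  in its two end terms. Since |l| = 1, the errors of \<open>j\<close> shifts merely add up.\<close>

lemma norm_cesaro_mean_shift_power_le:
  assumes l: "norm l = 1" and N: "0 < N"
  shows "norm (cesaro_mean l N (shift_power j x) - l ^ j * cesaro_mean l N x) \<le> 2 * real j * norm x / real N"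
proof (induction j)
  case (Suc j)
  define y where "y = shift_power j x"
  have l0: "l \<noteq> 0"
    using l by auto
  have "(\<Sum>m<N. inverse l ^ m * apply_bcontfun y (Suc m)) = l * (\<Sum>m<N. inverse l ^ Suc m * apply_bcontfun y (Suc m))"
    using l0 by (simp add: sum_distrib_left mult.assoc[symmetric])
  also have "(\<Sum>m<N. inverse l ^ Suc m * apply_bcontfun y (Suc m)) =
      (\<Sum>m<N. inverse l ^ m * apply_bcontfun y m) + (inverse l ^ N * apply_bcontfun y N - apply_bcontfun y 0)"
    using sum.lessThan_Suc_shift[of "\<lambda>m. inverse l ^ m * apply_bcontfun y m" N] by (simp add: algebra_simps)
  finally have "cesaro_mean l N (backward_shift y) - l * cesaro_mean l N y =
      l * (inverse l ^ N * apply_bcontfun y N - apply_bcontfun y 0) / of_nat N"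
    by (simp add: cesaro_mean_def distrib_left add_divide_distrib)
  moreover have "norm (l * (inverse l ^ N * apply_bcontfun y N - apply_bcontfun y 0)) \<le> norm y + norm y"
    using l norm_triangle_ineq4[of "inverse l ^ N * apply_bcontfun y N" "apply_bcontfun y 0"]
      norm_bounded[of y N] norm_bounded[of y 0]
    by (simp add: norm_mult norm_power norm_inverse)
  moreover have "norm y \<le> norm x"
    unfolding y_def by (intro norm_bound) (simp add: shift_power_apply norm_bounded)
  ultimately have step: "norm (cesaro_mean l N (backward_shift y) - l * cesaro_mean l N y) \<le> 2 * norm x / real N"
    using N by (auto simp: norm_divide intro!: divide_right_mono)
  have "norm (l * (cesaro_mean l N y - l ^ j * cesaro_mean l N x)) \<le> 2 * real j * norm x / real N"
    using Suc l by (simp add: y_def norm_mult)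
  from norm_triangle_mono[OF step this] show ?case
    by (simp add: y_def algebra_simps add_divide_distrib)
qed simp

context backward_shift_calculus
begin

text \<open>The error for the j-th power of the shift grows linearly in \<open>j\<close>, while the
  coefficients of \<open>f\<close> decay geometrically; the total error is O(1/N).\<close>

lemma cesaro_mean_T_tendsto:
  assumes l: "norm l = 1"
  shows "(\<lambda>N. cesaro_mean l N (T x) - f l * cesaro_mean l N x) \<longlonglongrightarrow> 0"
proof -
  obtain q where q: "1 < q" "q < \<rho>"
    using \<rho>(1) dense by blast
  define a where "a j = laurent_coeff f (int j)" for j
  define C where "C = (\<Sum>j. norm (a j) * (2 * real j))"
  have "norm (a j) \<le> M * (1 / q) ^ j" for j
    unfolding a_def using norm_laurent_coeff_le[OF holomorphic(2) bounded_annulus q, of "int j"] by simp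
  moreover have "0 \<le> M"
    using M[of 0] \<rho>(1) order_trans[OF norm_ge_zero] by fastforce
  ultimately have le: "norm (a j) * (2 * real j) \<le> 2 * M * (real (Suc j) * (1 / q) ^ j)" for j
    using mult_mono[of "norm (a j)" "M * (1 / q) ^ j" "2 * real j" "2 * real (Suc j)"] q
    by (simp add: algebra_simps)
  \<comment> \<open>The differentiated geometric series absorbs the linear factor.\<close>
  have "summable (\<lambda>j. real (Suc j) * (1 / q) ^ j)"
    using geometric_deriv_sums[of "1 / q"] q sums_summable by fastforce
  then have "summable (\<lambda>j. 2 * M * (real (Suc j) * (1 / q) ^ j))"
    by (rule summable_mult)
  then have summ: "summable (\<lambda>j. norm (a j) * (2 * real j))"
    by (rule summable_comparison_test'[where N = 0]) (use le in simp)
  have bound: "norm (cesaro_mean l N (T x) - f l * cesaro_mean l N x) \<le> C * norm x / real N" if N: "0 < N" for N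
  proof -
    define D where "D j = a j * (cesaro_mean l N (shift_power j x) - l ^ j * cesaro_mean l N x)" for j
    have "(\<lambda>j. \<Sum>m<N. inverse l ^ m * (a j * apply_bcontfun x (m + j))) sums
        (\<Sum>m<N. inverse l ^ m * apply_bcontfun (T x) m)"
      unfolding a_def by (intro sums_sum sums_mult T_sums)
    then have "(\<lambda>j. (\<Sum>m<N. inverse l ^ m * (a j * apply_bcontfun x (m + j))) / of_nat N) sums cesaro_mean l N (T x)"
      unfolding cesaro_mean_def by (rule sums_divide)
    moreover have "(\<Sum>m<N. inverse l ^ m * (a j * apply_bcontfun x (m + j))) / of_nat N =
        a j * cesaro_mean l N (shift_power j x)" for j
      by (simp add: cesaro_mean_def shift_power_apply sum_distrib_left mult_ac)
    ultimately have 1: "(\<lambda>j. a j * cesaro_mean l N (shift_power j x)) sums cesaro_mean l N (T x)"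
      by simp
    have "(\<lambda>j. a j * l ^ j * cesaro_mean l N x) sums (f l * cesaro_mean l N x)"
      unfolding a_def using power_series[of l] l \<rho>(1) by (intro sums_mult2) simp
    from sums_diff[OF 1 this] have sums: "D sums (cesaro_mean l N (T x) - f l * cesaro_mean l N x)"
      by (simp add: D_def[abs_def] right_diff_distrib mult.assoc)
    have norm_D: "norm (D j) \<le> norm (a j) * (2 * real j) * (norm x / real N)" for j
      unfolding D_def norm_mult
      using mult_left_mono[OF norm_cesaro_mean_shift_power_le[OF l N], of "norm (a j)"] by (simp add: mult_ac)
    have summ': "summable (\<lambda>j. norm (a j) * (2 * real j) * (norm x / real N))"
      by (intro summable_mult2 summ)
    have "norm (suminf D) \<le> (\<Sum>j. norm (a j) * (2 * real j) * (norm x / real N))"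
      using norm_D summ' by (rule norm_suminf_le)
    also have "\<dots> = C * norm x / real N"
      using suminf_mult2[OF summ, of "norm x / real N"] by (simp add: C_def)
    finally show ?thesis
      using sums by (simp add: sums_iff)
  qed
  have "(\<lambda>N. C * norm x / real N) \<longlonglongrightarrow> 0"
    by (rule lim_const_over_n)
  moreover have "\<forall>\<^sub>F N in sequentially. norm (cesaro_mean l N (T x) - f l * cesaro_mean l N x) \<le> C * norm x / real N"
    using eventually_gt_at_top[of 0] by eventually_elim (rule bound)
  ultimately show ?thesis
    by (rule Lim_null_comparison[rotated])
qed

lemma cesaro_mean_funpow_T_tendsto:
  assumes l: "norm l = 1"
  shows "(\<lambda>N. cesaro_mean l N ((blinfun_apply T ^^ k) x) - f l ^ k * cesaro_mean l N x) \<longlonglongrightarrow> 0"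
proof (induction k)
  case (Suc k)
  from tendsto_add[OF cesaro_mean_T_tendsto[OF l, of "(blinfun_apply T ^^ k) x"] tendsto_mult_left[OF Suc, of "f l"]]
  show ?case
    by (simp add: algebra_simps)
qed simp

text \<open>The seminorm \<open>limsup\<^sub>N \<bar>cesaro_mean l N x\<bar>\<close> is dominated by the norm, and \<open>f(B)\<close> multiplies it by
  \<open>\<bar>f l\<bar>\<close>; so if \<open>\<bar>f l\<bar> \<le> 1\<close>, then it bounds the points of \<^term>\<open>J_set T x\<close> by the norm of \<open>x\<close>.\<close>

lemma norm_f_gt_1_if_J_class:
  assumes J: "J_class T" and l: "norm l = 1"
  shows "1 < norm (f l)"
proof (rule ccontr)
  assume "\<not> 1 < norm (f l)"
  then have fl: "norm (f l) \<le> 1"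
    by simp
  obtain x where x: "J_set T x = UNIV"
    using J by (auto simp: J_class_def)
  \<comment> \<open>Any number above the norm of \<open>x\<close> would do: the means of
    \<open>y\<close> all equal \<open>c\<close>, but the estimate below bounds them by the norm of
    \<open>x\<close>.\<close>
  define c where "c = norm x + 1"
  define y where "y = of_real c *\<^sub>C geometric_seq l"
  have "y \<in> J_set T x"
    using x by simp
  then obtain k xs where xs: "xs \<longlonglongrightarrow> x" and lim: "(\<lambda>n. (blinfun_apply T ^^ k n) (xs n)) \<longlonglongrightarrow> y"
    by (auto simp: J_set_def)
  have l0: "l \<noteq> 0"
    using l by auto
  have mean_y: "cesaro_mean l N y = of_real c" if "0 < N" for N
  proof -
    have "inverse l ^ m * apply_bcontfun y m = of_real c" for m
      using l l0 by (simp add: y_def scaleC_complex_def geometric_seq_apply power_inverse)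
    then show ?thesis
      using that by (simp add: cesaro_mean_def)
  qed
  \<comment> \<open>The limits are taken in turn: \<open>N\<close> tends to infinity for fixed
    \<open>n\<close>, which removes the error \<open>E N\<close>, and \<open>n\<close>
    afterwards.\<close>
  have "c \<le> norm (y - (blinfun_apply T ^^ k n) (xs n)) + norm (xs n)" for n
  proof -
    define z where "z = (blinfun_apply T ^^ k n) (xs n)"
    define E where "E N = cesaro_mean l N z - f l ^ k n * cesaro_mean l N (xs n)" for N
    have "norm (f l ^ k n * cesaro_mean l N (xs n)) \<le> 1 * norm (xs n)" for N
      unfolding norm_mult norm_power
      using fl norm_cesaro_mean_le[OF l] by (intro mult_mono power_le_one) auto
    then have "c \<le> norm (y - z) + norm (xs n) + norm (E N)" if "0 < N" for N
    proof -
      have "of_real c = cesaro_mean l N (y - z) + E N + f l ^ k n * cesaro_mean l N (xs n)"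
        unfolding E_def cesaro_mean_diff using mean_y[OF that] by simp
      then have "norm (of_real c :: complex) \<le>
          norm (cesaro_mean l N (y - z)) + norm (E N) + norm (f l ^ k n * cesaro_mean l N (xs n))"
        by (metis norm_triangle_ineq norm_triangle_le add_right_mono)
      then show ?thesis
        using norm_cesaro_mean_le[OF l, of N "y - z"] \<open>\<And>N. norm (f l ^ k n * cesaro_mean l N (xs n)) \<le> 1 * norm (xs n)\<close>[of N]
        by (simp add: c_def)
    qed
    then have "\<forall>\<^sub>F N in sequentially. c \<le> norm (y - z) + norm (xs n) + norm (E N)"
      using eventually_gt_at_top[of 0] by (rule eventually_mono[rotated])
    moreover have "(\<lambda>N. norm (y - z) + norm (xs n) + norm (E N)) \<longlonglongrightarrow> norm (y - z) + norm (xs n) + 0"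
      unfolding E_def z_def
      by (intro tendsto_add tendsto_const tendsto_norm_zero cesaro_mean_funpow_T_tendsto[OF l])
    ultimately show ?thesis
      unfolding z_def using tendsto_lowerbound by fastforce
  qed
  moreover have "(\<lambda>n. norm (y - (blinfun_apply T ^^ k n) (xs n)) + norm (xs n)) \<longlonglongrightarrow> norm (y - y) + norm x"
    by (intro tendsto_intros xs lim)
  ultimately have "c \<le> norm (y - y) + norm x"
    by (intro LIMSEQ_le_const) auto
  then show False
    by (simp add: c_def)
qed

end

section \<open>The image of the unit disc\<close>

lemma cball_subset_image_ball:
  assumes U: "open U" "cball 0 1 \<subseteq> U" "f holomorphic_on U"
    and f: "\<And>z. norm z = 1 \<Longrightarrow> 1 < norm (f z)" and z0: "norm z0 < 1" "f z0 = 0"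
  shows "cball 0 1 \<subseteq> f ` ball 0 1"
proof -
  obtain \<rho> where \<rho>: "1 < \<rho>" "cball 0 \<rho> \<subseteq> U"
    using obtain_disc[OF U(1,2)] .
  have "f holomorphic_on ball 0 \<rho>"
    using \<rho>(2) by (intro holomorphic_on_subset[OF U(3)]) auto
  moreover have "\<not> f constant_on ball 0 \<rho>"
  proof
    assume "f constant_on ball 0 \<rho>"
    then have "f 1 = f z0"
      using z0(1) \<rho>(1) by (auto simp: constant_on_def)
    then show False
      using f[of 1] z0(2) by simp
  qed
  ultimately have op: "open (f ` ball 0 1)"
    using \<rho>(1) by (intro open_mapping_thm[of f "ball 0 \<rho>"]) auto
  \<comment> \<open>The circle is mapped outside the closed disc, so within it the open image equals
    a compact one and is both relatively open and closed.\<close>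
  have "cball 0 1 \<inter> f ` ball 0 1 = cball 0 1 \<inter> f ` cball 0 1"
    using f by (fastforce simp: le_less)
  moreover have "compact (f ` cball 0 1)"
    using U(2) by (intro compact_continuous_image continuous_on_subset[OF holomorphic_on_imp_continuous_on[OF U(3)]]) auto
  ultimately have "closedin (top_of_set (cball 0 1)) (cball 0 1 \<inter> f ` ball 0 1)"
    by (metis closedin_closed_Int compact_imp_closed)
  moreover have "openin (top_of_set (cball 0 1)) (cball 0 1 \<inter> f ` ball 0 1)"
    using op by (rule openin_open_Int)
  moreover have "0 \<in> cball 0 1 \<inter> f ` ball 0 1"
    using z0 by force
  ultimately show ?thesis
    using connected_cball[of "0::complex" 1] unfolding connected_clopen by blast
qed

theorem corollary3p13:
  fixes f :: "complex \<Rightarrow> complex" and U :: "complex set"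
  assumes "open U" and "cball 0 1 \<subseteq> U" and "f holomorphic_on U"
  shows "J_class (holomorphic_calculus U f backward_shift) \<longleftrightarrow>
    f ` sphere 0 1 \<inter> cball 0 1 = {} \<and> cball 0 1 \<subseteq> f ` ball 0 1"
proof -
  obtain r where r: "1 < r" "cball 0 r \<subseteq> U"
    using obtain_disc[OF assms(1,2)] .
  have cont: "continuous_on U f"
    using assms(3) holomorphic_on_imp_continuous_on by blast
  then have "compact (f ` cball 0 r)"
    using r(2) by (intro compact_continuous_image continuous_on_subset[OF cont]) auto
  then obtain M where M: "\<And>z. z \<in> cball 0 r \<Longrightarrow> norm (f z) \<le> M"
    using compact_imp_bounded bounded_pos by (metis imageI)
  \<comment> \<open>One bound \<open>M\<close> on the large disc serves every smaller radius; the
    radius is shrunk later.\<close>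
  have calc: "backward_shift_calculus f U \<rho> M" if "1 < \<rho>" "\<rho> \<le> r" for \<rho>
    using that assms r M by unfold_locales (auto simp: subset_iff)
  \<comment> \<open>The number \<kappa> lies strictly between 1 and the minimum of |f| on the
    circle, so it remains a lower bound on a thin annulus.\<close>
  have ann: "\<exists>\<rho> \<kappa>. 1 < \<rho> \<and> \<rho> \<le> r \<and> 1 < \<kappa> \<and> (\<forall>z\<in>annulus \<rho>. \<kappa> \<le> norm (f z))"
    if gt: "\<And>z. norm z = 1 \<Longrightarrow> 1 < norm (f z)"
  proof -
    have "compact ((\<lambda>z. norm (f z)) ` sphere 0 1)"
      using assms(2) by (intro compact_continuous_image continuous_intros continuous_on_subset[OF cont]) auto
    then obtain w where w: "norm w = 1" "\<And>z. norm z = 1 \<Longrightarrow> norm (f w) \<le> norm (f z)"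
      using compact_attains_inf[of "(\<lambda>z. norm (f z)) ` sphere 0 1"] by (force simp: image_iff)
    obtain \<kappa> where \<kappa>: "1 < \<kappa>" "\<kappa> < norm (f w)"
      using gt[OF w(1)] dense by blast
    have "open (U \<inter> (\<lambda>z. norm (f z)) -` {\<kappa><..})"
      using cont assms(1) by (intro continuous_open_preimage continuous_intros) auto
    moreover have "sphere 0 1 \<subseteq> U \<inter> (\<lambda>z. norm (f z)) -` {\<kappa><..}"
      using assms(2) w(2) \<kappa>(2) by (fastforce simp: subset_iff)
    ultimately obtain \<rho> where \<rho>: "1 < \<rho>" "annulus \<rho> \<subseteq> U \<inter> (\<lambda>z. norm (f z)) -` {\<kappa><..}"
      by (rule obtain_annulus)
    have "annulus (min \<rho> r) \<subseteq> annulus \<rho>"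
      using \<rho>(1) r(1) by (intro annulus_mono) auto
    then have "\<forall>z\<in>annulus (min \<rho> r). \<kappa> \<le> norm (f z)"
      using \<rho>(2) by fastforce
    then show ?thesis
      using \<rho>(1) r(1) \<kappa>(1) by (intro exI[of _ "min \<rho> r"] exI[of _ \<kappa>]) auto
  qed
  show ?thesis
  proof
    assume J: "J_class (holomorphic_calculus U f backward_shift)"
    interpret backward_shift_calculus f U r M
      using calc r(1) by blast
    have gt: "1 < norm (f z)" if "norm z = 1" for z
      using norm_f_gt_1_if_J_class[of z] J that by (simp add: T_def)
    obtain \<rho> \<kappa> where \<rho>: "1 < \<rho>" "\<rho> \<le> r" "1 < \<kappa>" "\<forall>z\<in>annulus \<rho>. \<kappa> \<le> norm (f z)"
      using ann gt by blast
    \<comment> \<open>A second instance of the same operator: the first, on the large disc, yields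
      |f| > 1 on the circle, and only then is the radius of the annulus available.\<close>
    interpret A: backward_shift_calculus f U \<rho> M
      using calc \<rho> by blast
    obtain z0 where "norm z0 < 1" "f z0 = 0"
      using A.zero_if_J_class[of \<kappa>] \<rho> J by (auto simp: A.T_def)
    then have "cball 0 1 \<subseteq> f ` ball 0 1"
      using cball_subset_image_ball[OF assms gt] by blast
    moreover have "f ` sphere 0 1 \<inter> cball 0 1 = {}"
      using gt by fastforce
    ultimately show "f ` sphere 0 1 \<inter> cball 0 1 = {} \<and> cball 0 1 \<subseteq> f ` ball 0 1"
      by blast
  next
    assume R: "f ` sphere 0 1 \<inter> cball 0 1 = {} \<and> cball 0 1 \<subseteq> f ` ball 0 1"
    then have gt: "1 < norm (f z)" if "norm z = 1" for z
      using that by (auto simp: disjoint_iff not_le[symmetric])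
    obtain \<rho> \<kappa> where \<rho>: "1 < \<rho>" "\<rho> \<le> r" "1 < \<kappa>" "\<forall>z\<in>annulus \<rho>. \<kappa> \<le> norm (f z)"
      using ann gt by blast
    interpret A: backward_shift_calculus f U \<rho> M
      using calc \<rho> by blast
    have "0 \<in> f ` ball 0 1"
      using R by auto
    then obtain z0 where "norm z0 < 1" "f z0 = 0"
      by auto
    then have "J_class A.T"
      using A.J_class_if_zero[of \<kappa>] \<rho> by blast
    then show "J_class (holomorphic_calculus U f backward_shift)"
      by (simp add: A.T_def)
  qed
qed

end
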